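(* Let $0<\alpha<1$, $m\in L^\infty(\Omega)$, $|\Omega^+|>0$ and $|\Omega^-|>0$. Suppose there exist $\rho_0>0$ and $m_{\rho_0}^->0$ such that $$\mathcal C_{\rho_0}\subset\Omega^-\qquad\text{and}\qquad -m(x)\ge m_{\rho_0}^-\ \text{ for a.e. }x\in\mathcal C_{\rho_0}.$$ Then there exists $\sigma<0$ such that for every $\lambda<\sigma$ the solution $u_\lambda^+$ has compact support in $\Omega$. More precisely, there exists $\rho\in(0,\rho_0)$, independent of all sufficiently negative $\lambda$, such that $u_\lambda^+=0$ in $\mathcal C_\rho$; consequently $$\operatorname{supp}u_\lambda^+\subset\{x\in\Omega:\operatorname{dist}(x,\partial\Omega)\ge\rho\}\Subset\Omega .$$
   Context: $\Omega\subset\mathbb R^N$, $N\ge1$, is a bounded connected domain with sufficiently smooth boundary; $\Omega^\pm=\{x\in\Omega:\pm m(x)>0\}$; $|A|$ is the Lebesgue measure; $\mathcal C_\rho=\{x\in\Omega:\operatorname{dist}(x,\partial\Omega)<\rho\}$. Problem $(P_\lambda)$: $-\Delta u=\lambda u+m(x)|u|^{\alpha-1}u$ in $\Omega$, $u=0$ on $\partial\Omega$ (weak solutions in $H_0^1(\Omega)$). $H_\lambda(u)=\int_\Omega(|\nabla u|^2-\lambda u^2)dx$, $M(u)=\int_\Omega m|u|^{\alpha+1}dx$, $E_\lambda(u)=\frac12H_\lambda(u)-\frac1{\alpha+1}M(u)$, and $\mathcal N_\lambda^+=\{u\in H_0^1(\Omega)\setminus\{0\}:H_\lambda(u)=M(u),\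 H_\lambda(u)-\alpha M(u)>0\}$. For $\lambda<\lambda^*$, where $\lambda^*=\inf\{\int_\Omega|\nabla u|^2dx/\int_\Omega u^2dx:u\in H_0^1(\Omega)\setminus\{0\},M(u)\ge0\}>0$, $u_\lambda^+$ denotes a non-negative weak solution of $(P_\lambda)$ belonging to $\mathcal N_\lambda^+$ with $E_\lambda(u_\lambda^+)=\inf_{\mathcal N_\lambda^+}E_\lambda$ (the solution constructed in the paper; such solutions exist when $|\Omega^+|>0$, are continuous on $\overline\Omega$, and one is fixed for each $\lambda$). *)

theory Defs
  imports "HOL-Analysis.Analysis"
begin

fun Ck_on :: "nat \<Rightarrow> 'a::euclidean_space set \<Rightarrow> ('a \<Rightarrow> real) \<Rightarrow> bool" where
  "Ck_on 0 S f \<longleftrightarrow> continuous_on S f"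
| "Ck_on (Suc k) S f \<longleftrightarrow>
     (\<forall>x\<in>S. f differentiable (at x)) \<and>
     (\<forall>b\<in>Basis. Ck_on k S (\<lambda>x. frechet_derivative f (at x) b))"

text \<open>
  Near each boundary point, after choosing a unit vector \<open>e\<close> as the vertical direction, the set is
  the region above the graph of a \<open>Ck\<close> function of the orthogonal coordinates.  The function
  \<open>\<gamma>\<close> is only evaluated on the hyperplane orthogonal to \<open>e\<close>, a copy of
  \<open>(N-1)\<close>-dimensional space; this includes the case of dimension one.
\<close>

definition Ck_boundary :: "nat \<Rightarrow> 'a::euclidean_space set \<Rightarrow> bool" where
  "Ck_boundary k \<Omega> \<longleftrightarrow>
     (\<forall>p\<in>frontier \<Omega>. \<exists>r>0. \<exists>e \<gamma>. norm e = 1 \<and> Ck_on k UNIV \<gamma> \<and>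
        \<Omega> \<inter> ball p r = {x \<in> ball p r. x \<bullet> e > \<gamma> (x - (x \<bullet> e) *\<^sub>R e)})"

definition test_functions :: "(real^'n) set \<Rightarrow> (real^'n \<Rightarrow> real) set" where
  "test_functions \<Omega> =
     {\<phi>. (\<forall>k. Ck_on k UNIV \<phi>) \<and> compact (closure {x. \<phi> x \<noteq> 0}) \<and> closure {x. \<phi> x \<noteq> 0} \<subseteq> \<Omega>}"

definition grad :: "(real^'n \<Rightarrow> real) \<Rightarrow> real^'n \<Rightarrow> real^'n" where
  "grad f x = (\<chi> i. frechet_derivative f (at x) (axis i 1))"

text \<open>
  The function spaces below consist of representatives; equality in them is equality almost
  everywhere in \<open>\<Omega>\<close>, and values outside \<open>\<Omega>\<close> are irrelevant.
\<close>

definition L2 :: "(real^'n) set \<Rightarrow> (real^'n \<Rightarrow> 'b::euclidean_space) set" where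
  "L2 \<Omega> = {f \<in> borel_measurable (lebesgue_on \<Omega>).
              integrable (lebesgue_on \<Omega>) (\<lambda>x. (norm (f x))\<^sup>2)}"

definition Linfty :: "(real^'n) set \<Rightarrow> (real^'n \<Rightarrow> real) set" where
  "Linfty \<Omega> = {f \<in> borel_measurable (lebesgue_on \<Omega>).
                 \<exists>K. AE x in lebesgue_on \<Omega>. \<bar>f x\<bar> \<le> K}"

definition has_weak_gradient ::
  "(real^'n) set \<Rightarrow> (real^'n \<Rightarrow> real) \<Rightarrow> (real^'n \<Rightarrow> real^'n) \<Rightarrow> bool" where
  "has_weak_gradient \<Omega> u g \<longleftrightarrow>
     (\<forall>\<phi>\<in>test_functions \<Omega>.
        (LINT x|lebesgue_on \<Omega>. u x *\<^sub>R grad \<phi> x) = - (LINT x|lebesgue_on \<Omega>. \<phi> x *\<^sub>R g x))"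

definition H1 :: "(real^'n) set \<Rightarrow> (real^'n \<Rightarrow> real) set" where
  "H1 \<Omega> = {u \<in> L2 \<Omega>. \<exists>g\<in>L2 \<Omega>. has_weak_gradient \<Omega> u g}"

text \<open>The weak gradient is determined almost everywhere in \<open>\<Omega>\<close>; a representative is chosen.\<close>

definition weak_grad :: "(real^'n) set \<Rightarrow> (real^'n \<Rightarrow> real) \<Rightarrow> real^'n \<Rightarrow> real^'n" where
  "weak_grad \<Omega> u = (SOME g. g \<in> L2 \<Omega> \<and> has_weak_gradient \<Omega> u g)"

definition H01 :: "(real^'n) set \<Rightarrow> (real^'n \<Rightarrow> real) set" where
  "H01 \<Omega> = {u \<in> H1 \<Omega>. \<exists>\<phi>. (\<forall>n::nat. \<phi> n \<in> test_functions \<Omega>) \<and>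
     (\<lambda>n. (LINT x|lebesgue_on \<Omega>. (\<phi> n x - u x)\<^sup>2)
         + (LINT x|lebesgue_on \<Omega>. (norm (grad (\<phi> n) x - weak_grad \<Omega> u x))\<^sup>2)) \<longlonglongrightarrow> 0}"

definition H01_nonzero :: "(real^'n) set \<Rightarrow> (real^'n \<Rightarrow> real) set" where
  "H01_nonzero \<Omega> = {u \<in> H01 \<Omega>. \<not> (AE x in lebesgue_on \<Omega>. u x = 0)}"

definition pos_set :: "(real^'n) set \<Rightarrow> (real^'n \<Rightarrow> real) \<Rightarrow> (real^'n) set" where
  "pos_set \<Omega> m = {x \<in> \<Omega>. m x > 0}"

definition neg_set :: "(real^'n) set \<Rightarrow> (real^'n \<Rightarrow> real) \<Rightarrow> (real^'n) set" where
  "neg_set \<Omega> m = {x \<in> \<Omega>. - m x > 0}"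

definition collar :: "(real^'n) set \<Rightarrow> real \<Rightarrow> (real^'n) set" where
  "collar \<Omega> \<rho> = {x \<in> \<Omega>. infdist x (frontier \<Omega>) < \<rho>}"

text \<open>
  Since \<open>0 powr a = 0\<close> for every \<open>a\<close>, the term \<open>\<bar>u\<bar> powr (\<alpha> - 1) * u\<close> vanishes where \<open>u\<close> does,
  also for \<open>\<alpha> < 1\<close>.
\<close>

definition weak_solution ::
  "(real^'n) set \<Rightarrow> (real^'n \<Rightarrow> real) \<Rightarrow> real \<Rightarrow> real \<Rightarrow> (real^'n \<Rightarrow> real) \<Rightarrow> bool" where
  "weak_solution \<Omega> m \<alpha> lam u \<longleftrightarrow> u \<in> H01 \<Omega> \<and>
     (\<forall>v\<in>H01 \<Omega>. (LINT x|lebesgue_on \<Omega>. weak_grad \<Omega> u x \<bullet> weak_grad \<Omega> v x)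
        = (LINT x|lebesgue_on \<Omega>. (lam * u x + m x * (\<bar>u x\<bar> powr (\<alpha> - 1) * u x)) * v x))"

definition H_fun :: "(real^'n) set \<Rightarrow> real \<Rightarrow> (real^'n \<Rightarrow> real) \<Rightarrow> real" where
  "H_fun \<Omega> lam u = (LINT x|lebesgue_on \<Omega>. (norm (weak_grad \<Omega> u x))\<^sup>2 - lam * (u x)\<^sup>2)"

definition M_fun ::
  "(real^'n) set \<Rightarrow> (real^'n \<Rightarrow> real) \<Rightarrow> real \<Rightarrow> (real^'n \<Rightarrow> real) \<Rightarrow> real" where
  "M_fun \<Omega> m \<alpha> u = (LINT x|lebesgue_on \<Omega>. m x * \<bar>u x\<bar> powr (\<alpha> + 1))"

definition E_fun ::
  "(real^'n) set \<Rightarrow> (real^'n \<Rightarrow> real) \<Rightarrow> real \<Rightarrow> real \<Rightarrow> (real^'n \<Rightarrow> real) \<Rightarrow> real" where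
  "E_fun \<Omega> m \<alpha> lam u = 1 / 2 * H_fun \<Omega> lam u - 1 / (\<alpha> + 1) * M_fun \<Omega> m \<alpha> u"

definition nehari_plus ::
  "(real^'n) set \<Rightarrow> (real^'n \<Rightarrow> real) \<Rightarrow> real \<Rightarrow> real \<Rightarrow> (real^'n \<Rightarrow> real) set" where
  "nehari_plus \<Omega> m \<alpha> lam =
     {u \<in> H01_nonzero \<Omega>. H_fun \<Omega> lam u = M_fun \<Omega> m \<alpha> u \<and> H_fun \<Omega> lam u - \<alpha> * M_fun \<Omega> m \<alpha> u > 0}"

definition lambda_star ::
  "(real^'n) set \<Rightarrow> (real^'n \<Rightarrow> real) \<Rightarrow> real \<Rightarrow> ereal" where
  "lambda_star \<Omega> m \<alpha> =
     (INF u\<in>{u \<in> H01_nonzero \<Omega>. M_fun \<Omega> m \<alpha> u \<ge> 0}.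
        ereal ((LINT x|lebesgue_on \<Omega>. (norm (weak_grad \<Omega> u x))\<^sup>2)
               / (LINT x|lebesgue_on \<Omega>. (u x)\<^sup>2)))"

text \<open>
  Pointwise statements about a ground state refer to its representative that is continuous on
  \<open>closure \<Omega>\<close>, as provided by elliptic regularity.
\<close>

definition plus_ground_state ::
  "(real^'n) set \<Rightarrow> (real^'n \<Rightarrow> real) \<Rightarrow> real \<Rightarrow> real \<Rightarrow> (real^'n \<Rightarrow> real) \<Rightarrow> bool" where
  "plus_ground_state \<Omega> m \<alpha> lam u \<longleftrightarrow>
     continuous_on (closure \<Omega>) u \<and> (\<forall>x\<in>\<Omega>. u x \<ge> 0) \<and>
     weak_solution \<Omega> m \<alpha> lam u \<and> u \<in> nehari_plus \<Omega> m \<alpha> lam \<and>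
     ereal (E_fun \<Omega> m \<alpha> lam u) = (INF v\<in>nehari_plus \<Omega> m \<alpha> lam. ereal (E_fun \<Omega> m \<alpha> lam v))"

definition supp_in :: "(real^'n) set \<Rightarrow> (real^'n \<Rightarrow> real) \<Rightarrow> (real^'n) set" where
  "supp_in \<Omega> u = closure {x \<in> \<Omega>. u x \<noteq> 0}"

definition compactly_contained :: "(real^'n) set \<Rightarrow> (real^'n) set \<Rightarrow> bool" where
  "compactly_contained A \<Omega> \<longleftrightarrow> compact (closure A) \<and> closure A \<subseteq> \<Omega>"

end

theory Submission
  imports Defs
begin

text \<open>
  The core is a comparison principle: if \<open>w \<ge> 0\<close> is smooth and
  \<open>\<lambda>u + m u\<^sup>\<alpha> + \<Delta>w < 0\<close> almost everywhere on \<open>{u > w}\<close>, then \<open>u \<le> w\<close>.  A constant \<open>w = \<kappa>\<close> gives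
  \<open>u \<le> \<kappa>\<close> as soon as \<open>\<bar>\<lambda>\<bar> \<kappa>\<^bsup>1-\<alpha>\<^esup>\<close> exceeds the bound of \<open>m\<close>, so \<open>u\<close> tends to \<open>0\<close> uniformly as
  \<open>\<lambda> \<rightarrow> -\<infinity>\<close>.  Around a point \<open>x\<^sub>0\<close> at distance less than \<open>\<rho>\<^sub>0/2\<close> from the boundary, take
  \<open>w = c\<bar>x - x\<^sub>0\<bar>\<^bsup>2k\<^esup>\<close> with \<open>k (1 - \<alpha>) \<ge> 1\<close> and \<open>\<Delta>w \<le> m\<^sub>0 w\<^sup>\<alpha>\<close>: outside the collar, \<open>w\<close> is at least
  \<open>c(\<rho>\<^sub>0/2)\<^bsup>2k\<^esup> \<ge> u\<close>, and inside it the absorption \<open>-m\<^sub>0 u\<^sup>\<alpha>\<close> dominates \<open>\<Delta>w\<close>.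
  Hence \<open>u(x\<^sub>0) \<le> w(x\<^sub>0) = 0\<close>.  The boundary values of \<open>u\<close> enter only through its
  approximation by test functions.
\<close>

subsection \<open>Smooth functions\<close>

text \<open>Continuity of the function itself is recovered from differentiability in the base case;
  the step applies the induction hypothesis to the partial derivatives.\<close>

lemma Ck_on_SucD: "Ck_on (Suc k) S f \<Longrightarrow> Ck_on k S f"
proof (induction k arbitrary: f)
  case 0
  then show ?case
    by (auto intro!: continuous_at_imp_continuous_on differentiable_imp_continuous_within)
next
  case (Suc k)
  from Suc.prems have "\<forall>b\<in>Basis. Ck_on (Suc k) S (\<lambda>x. frechet_derivative f (at x) b)"
    by (simp only: Ck_on.simps(2)) blast
  then have "\<forall>b\<in>Basis. Ck_on k S (\<lambda>x. frechet_derivative f (at x) b)"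
    using Suc.IH by blast
  then show ?case using Suc.prems by (simp only: Ck_on.simps(2)) blast
qed

text \<open>Derivatives are unique, so an explicit formula \<open>D\<close> may stand for the chosen
  \<open>frechet_derivative\<close>. The closure properties below rest on this rule.\<close>

lemma Ck_on_SucI:
  assumes "\<And>x. (f has_derivative D x) (at x)"
    and "\<And>b. b \<in> Basis \<Longrightarrow> Ck_on k UNIV (\<lambda>x. D x b)"
  shows "Ck_on (Suc k) UNIV f"
proof -
  have "frechet_derivative f (at x) = D x" for x
    using frechet_derivative_at[OF assms(1)] by simp
  then show ?thesis
    using assms by (auto simp: differentiable_def)
qed

lemma Ck_on_Suc_has_derivative:
  "Ck_on (Suc k) UNIV f \<Longrightarrow> (f has_derivative frechet_derivative f (at x)) (at x)"
  by (simp add: frechet_derivative_works)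

lemma Ck_on_const: "Ck_on k UNIV (\<lambda>x. c)"
proof (induction k arbitrary: c)
  case (Suc k)
  show ?case by (rule Ck_on_SucI[where D = "\<lambda>x h. 0"]) (use Suc in auto)
qed simp

lemma Ck_on_add:
  "Ck_on k UNIV f \<Longrightarrow> Ck_on k UNIV g \<Longrightarrow> Ck_on k UNIV (\<lambda>x. f x + g x)"
proof (induction k arbitrary: f g)
  case 0
  then show ?case by (auto intro: continuous_intros)
next
  case (Suc k)
  show ?case
  proof (rule Ck_on_SucI[OF has_derivative_add])
    show "(f has_derivative frechet_derivative f (at x)) (at x)"
      "(g has_derivative frechet_derivative g (at x)) (at x)" for x
      using Suc.prems Ck_on_Suc_has_derivative by blast+
  qed (use Suc in auto)
qed

lemma Ck_on_mult:
  "Ck_on k UNIV f \<Longrightarrow> Ck_on k UNIV g \<Longrightarrow> Ck_on k UNIV (\<lambda>x. f x * g x)"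
proof (induction k arbitrary: f g)
  case 0
  then show ?case by (auto intro: continuous_intros)
next
  case (Suc k)
  show ?case
  proof (rule Ck_on_SucI[OF has_derivative_mult])
    show "(f has_derivative frechet_derivative f (at x)) (at x)"
      "(g has_derivative frechet_derivative g (at x)) (at x)" for x
      using Suc.prems Ck_on_Suc_has_derivative by blast+
    have fg: "Ck_on k UNIV f" "Ck_on k UNIV g" using Suc.prems by (blast dest: Ck_on_SucD)+
    show "Ck_on k UNIV (\<lambda>x. f x * frechet_derivative g (at x) b + frechet_derivative f (at x) b * g x)"
      if "b \<in> Basis" for b
      using that Suc fg by (intro Ck_on_add) auto
  qed
qed

text \<open>By the chain rule each partial derivative is the derivative of \<open>G\<close>,
  composed with \<open>f\<close>, times a partial derivative of \<open>f\<close>. The induction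
  hypothesis handles the first factor with the derivative of \<open>G\<close> in place of
  \<open>G\<close>.\<close>

lemma Ck_on_comp:
  fixes G :: "real \<Rightarrow> real"
  shows "Ck_on k UNIV G \<Longrightarrow> Ck_on k UNIV f \<Longrightarrow> Ck_on k UNIV (\<lambda>x. G (f x))"
proof (induction k arbitrary: f G)
  case 0
  then show ?case by (auto intro: continuous_on_compose2)
next
  case (Suc k)
  have f: "(f has_derivative frechet_derivative f (at x)) (at x)"
    and G: "(G has_derivative frechet_derivative G (at (f x))) (at (f x))" for x
    using Suc.prems Ck_on_Suc_has_derivative by blast+
  \<comment> \<open>A linear map on the reals is multiplication by its value at \<open>1\<close>;
    this turns the composed derivative into a product.\<close>
  have *: "frechet_derivative G (at y) h = frechet_derivative G (at y) 1 * h" for y h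
  proof -
    have "linear (frechet_derivative G (at y))"
      using Ck_on_Suc_has_derivative[OF Suc.prems(1)] has_derivative_linear by blast
    from linear_scale[OF this, of h 1] show ?thesis by simp
  qed
  have "Ck_on k UNIV (\<lambda>x. frechet_derivative G (at (f x)) 1 * frechet_derivative f (at x) b)"
    if "b \<in> Basis" for b
  proof (rule Ck_on_mult, rule Suc.IH[of "\<lambda>y. frechet_derivative G (at y) 1"])
    show "Ck_on k UNIV f" using Suc.prems(2) by (rule Ck_on_SucD)
  qed (use that Suc.prems in simp_all)
  moreover have "(\<lambda>x. frechet_derivative G (at (f x)) (frechet_derivative f (at x) b)) =
      (\<lambda>x. frechet_derivative G (at (f x)) 1 * frechet_derivative f (at x) b)" for b
    by (rule ext) (rule *)
  ultimately have "Ck_on k UNIV (\<lambda>x. frechet_derivative G (at (f x)) (frechet_derivative f (at x) b))"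
    if "b \<in> Basis" for b
    using that by metis
  then show ?case
    by (rule Ck_on_SucI[OF has_derivative_compose[OF f G]])
qed

lemma Ck_on_bounded_linear:
  assumes "bounded_linear f" shows "Ck_on k UNIV f"
proof (cases k)
  case 0
  then show ?thesis by (simp add: assms linear_continuous_on)
next
  case (Suc l)
  show ?thesis
    unfolding Suc by (rule Ck_on_SucI[OF bounded_linear_imp_has_derivative[OF assms] Ck_on_const])
qed

text \<open>The regularity half of \<open>test_functions\<close>, kept apart from the support
  condition so that it also applies to barriers and to functions of one real variable.\<close>

definition smooth :: "('a::euclidean_space \<Rightarrow> real) \<Rightarrow> bool" where
  "smooth f \<longleftrightarrow> (\<forall>k. Ck_on k UNIV f)"

lemma smooth_const: "smooth (\<lambda>x. c)"
  and smooth_add: "smooth f \<Longrightarrow> smooth g \<Longrightarrow> smooth (\<lambda>x. f x + g x)"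
  and smooth_mult: "smooth f \<Longrightarrow> smooth g \<Longrightarrow> smooth (\<lambda>x. f x * g x)"
  and smooth_comp: "smooth G \<Longrightarrow> smooth f \<Longrightarrow> smooth (\<lambda>x. G (f x))"
  and smooth_bounded_linear: "bounded_linear f \<Longrightarrow> smooth f"
  by (auto simp: smooth_def Ck_on_const Ck_on_add Ck_on_mult Ck_on_comp Ck_on_bounded_linear)

lemma smooth_diff:
  assumes "smooth f" "smooth g" shows "smooth (\<lambda>x. f x - g x)"
  using smooth_add[OF assms(1) smooth_mult[OF smooth_const assms(2)], of "-1"] by simp

lemma smooth_inner: "smooth (\<lambda>x. x \<bullet> b)"
  by (rule smooth_bounded_linear[OF bounded_linear_inner_left])

lemma smooth_sum: "(\<And>i. i \<in> I \<Longrightarrow> smooth (f i)) \<Longrightarrow> smooth (\<lambda>x. \<Sum>i\<in>I. f i x)"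
  by (induction I rule: infinite_finite_induct) (auto intro: smooth_const smooth_add)

lemma smooth_prod: "(\<And>i. i \<in> I \<Longrightarrow> smooth (f i)) \<Longrightarrow> smooth (\<lambda>x. \<Prod>i\<in>I. f i x)"
  by (induction I rule: infinite_finite_induct) (auto intro: smooth_const smooth_mult)

lemma smooth_power: "smooth f \<Longrightarrow> smooth (\<lambda>x. f x ^ k)"
  by (induction k) (auto intro: smooth_const smooth_mult)

lemma smooth_has_derivative: "smooth f \<Longrightarrow> (f has_derivative frechet_derivative f (at x)) (at x)"
  unfolding smooth_def using Ck_on_Suc_has_derivative[of 0] by blast

lemma smooth_frechet_derivative:
  assumes "smooth f" "b \<in> Basis" shows "smooth (\<lambda>x. frechet_derivative f (at x) b)"
  unfolding smooth_def
proof
  fix k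
  have "Ck_on (Suc k) UNIV f" using assms by (simp add: smooth_def del: Ck_on.simps)
  then show "Ck_on k UNIV (\<lambda>x. frechet_derivative f (at x) b)" using assms by simp
qed

lemma smooth_continuous_on: "smooth f \<Longrightarrow> continuous_on S f"
  unfolding smooth_def by (metis Ck_on.simps(1) continuous_on_subset top_greatest)

text \<open>The case \<open>n = 0\<close> is the classical smooth function that is flat to infinite
  order at \<open>0\<close>. The powers in the denominator are those produced by differentiating
  it.\<close>

definition flat :: "nat \<Rightarrow> real \<Rightarrow> real" where
  "flat n t = (if t > 0 then exp (- 1 / t) / t ^ n else 0)"

lemma flat_nonneg: "0 \<le> flat n t" and flat_pos: "0 < t \<Longrightarrow> 0 < flat n t"
  and flat_nonpos_eq: "t \<le> 0 \<Longrightarrow> flat n t = 0"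
  by (auto simp: flat_def)

text \<open>Raise \<open>y \<le> exp y\<close> with \<open>y = 1 / (N * t)\<close> and
  \<open>N = n + k\<close> to the power \<open>N\<close>. A positive \<open>k\<close> gives decay at
  \<open>0\<close>, and \<open>k = 0\<close> gives a uniform bound.\<close>

lemma flat_le:
  assumes "0 \<le> t" "0 < n + k"
  shows "flat n t \<le> real (n + k) ^ (n + k) * t ^ k"
proof (cases "t > 0")
  case True
  define N where "N = n + k"
  have N: "N > 0" using assms by (simp add: N_def)
  have "(1 / (real N * t)) ^ N \<le> exp (1 / (real N * t)) ^ N"
    using True N exp_ge_add_one_self[of "1 / (real N * t)"]
      True N by (intro power_mono) (linarith | simp)+
  also have "\<dots> = exp (1 / t)"
    using N True by (simp flip: exp_of_nat_mult)
  finally have "exp (- 1 / t) \<le> real N ^ N * t ^ N"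
    using N True by (simp add: exp_minus field_simps power_mult_distrib)
  then have "exp (- 1 / t) / t ^ n \<le> real N ^ N * t ^ N / t ^ n"
    using True by (intro divide_right_mono) auto
  then show ?thesis
    using True by (simp add: flat_def N_def power_add)
qed (use assms in \<open>auto simp: flat_def\<close>)

lemma flat_has_real_derivative:
  "(flat n has_real_derivative flat (n + 2) t - real n * flat (n + 1) t) (at t)"
proof -
  consider "t < 0" | "t = 0" | "t > 0" by linarith
  then show ?thesis
  proof cases
    case 1
    have "((\<lambda>_. 0) has_real_derivative 0) (at t)" by simp
    then have "(flat n has_real_derivative 0) (at t)"
      by (rule has_field_derivative_transform_within_open[of _ _ _ "{..<0}"])
        (use 1 in \<open>auto simp: flat_nonpos_eq\<close>)
    then show ?thesis using 1 by (simp add: flat_nonpos_eq)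
  next
    case 2
    \<comment> \<open>This is the constant of \<open>flat_le\<close> for \<open>k = 2\<close>: one
      factor \<open>h\<close> survives the division by \<open>h\<close>, so the difference quotients
      at \<open>0\<close> tend to \<open>0\<close>.\<close>
    define C where "C = real (n + 2) ^ (n + 2)"
    have "C \<ge> 0" by (simp add: C_def)
    have "\<bar>flat n h / h\<bar> \<le> C * \<bar>h\<bar>" for h
    proof (cases "h > 0")
      case True
      have "flat n h \<le> C * h ^ 2" using flat_le[of h n 2] True by (simp add: C_def)
      then show ?thesis using True flat_nonneg[of n h]
        by (simp add: abs_mult field_simps power2_eq_square)
    qed (use \<open>C \<ge> 0\<close> in \<open>simp add: flat_nonpos_eq mult_nonneg_nonpos\<close>)
    moreover have "((\<lambda>h. C * \<bar>h\<bar>) \<longlongrightarrow> C * \<bar>0\<bar>) (at 0)"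
      by (intro tendsto_intros)
    ultimately have "((\<lambda>h. flat n h / h) \<longlongrightarrow> 0) (at 0)"
      using Lim_null_comparison[of "\<lambda>h. flat n h / h" "\<lambda>h. C * \<bar>h\<bar>" "at 0"] by simp
    then have "(flat n has_real_derivative 0) (at 0)"
      by (simp add: DERIV_def flat_nonpos_eq)
    then show ?thesis using 2 by (simp add: flat_nonpos_eq)
  next
    case 3
    have "((\<lambda>t. exp (- 1 / t) / t ^ n) has_real_derivative
        flat (n + 2) t - real n * flat (n + 1) t) (at t)"
    proof (rule DERIV_cong)
      show "((\<lambda>t. exp (- 1 / t) / t ^ n) has_real_derivative
          (exp (- 1 / t) * (1 / t\<^sup>2) * t ^ n - exp (- 1 / t) * (real n * t ^ (n - 1))) / (t ^ n * t ^ n)) (at t)"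
        using 3 by (auto intro!: derivative_eq_intros simp: power2_eq_square)
      \<comment> \<open>For \<open>n = 0\<close> the truncated exponent \<open>n - 1\<close> does no
        harm, because the factor \<open>real n\<close> vanishes.\<close>
      have "real n * t ^ n = t * (real n * t ^ (n - 1))" by (cases n) auto
      then show "(exp (- 1 / t) * (1 / t\<^sup>2) * t ^ n - exp (- 1 / t) * (real n * t ^ (n - 1))) / (t ^ n * t ^ n) =
          flat (n + 2) t - real n * flat (n + 1) t"
        using 3 by (simp add: flat_def divide_simps power_add power2_eq_square) (simp add: algebra_simps)
    qed
    then show ?thesis
      by (rule has_field_derivative_transform_within_open[of _ _ _ "{0<..}"])
        (use 3 in \<open>auto simp: flat_def\<close>)
  qed
qed

text \<open>The derivative is a linear combination of other members of the family, so the induction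
  on the order runs over all \<open>n\<close> at once.\<close>

lemma smooth_flat: "smooth (flat n)"
  unfolding smooth_def
proof
  show "Ck_on k UNIV (flat n)" for k
  proof (induction k arbitrary: n)
    case 0
    show ?case unfolding Ck_on.simps
      by (rule DERIV_continuous_on)
        (use flat_has_real_derivative has_field_derivative_at_within in blast)
  next
    case (Suc k)
    show ?case
    proof (rule Ck_on_SucI)
      show "(flat n has_derivative (\<lambda>h. (flat (n + 2) t - real n * flat (n + 1) t) * h)) (at t)" for t
        using flat_has_real_derivative has_field_derivative_def by blast
      have "Ck_on k UNIV (\<lambda>t. flat (n + 2) t + (- real n) * flat (n + 1) t)"
        by (intro Ck_on_add Ck_on_mult Ck_on_const Suc.IH)
      then show "Ck_on k UNIV (\<lambda>t. (flat (n + 2) t - real n * flat (n + 1) t) * b)"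
        if "b \<in> Basis" for b :: real
        using that by simp
    qed
  qed
qed

lemma flat_zero_has_derivative:
  "(flat 0 has_real_derivative flat 2 t) (at t)"
  using flat_has_real_derivative[of 0 t] by (simp add: numeral_2_eq_2)

lemma flat_two_le: "flat 2 t \<le> 4"
  using flat_le[of t 2 0] by (cases "t > 0") (auto simp: flat_nonpos_eq)

lemma flat_zero_le: "flat 0 t \<le> 1"
  by (auto simp: flat_def)

text \<open>Mean value inequality: the derivative \<open>flat 2\<close> takes values between
  \<open>0\<close> and \<open>4\<close>.\<close>

lemma flat_zero_lipschitz: "\<bar>flat 0 s - flat 0 t\<bar> \<le> 4 * \<bar>s - t\<bar>"
  using field_differentiable_bound[of UNIV "flat 0" "flat 2" 4 s t]
  by (simp add: flat_zero_has_derivative flat_two_le flat_nonneg)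

text \<open>Composed with a nonnegative smooth function, this approximates the indicator of its
  positivity set by smooth functions.\<close>

lemma flat_zero_scale_tendsto:
  "(\<lambda>k. flat 0 (real k * s)) \<longlonglongrightarrow> (if s > 0 then 1 else 0)"
proof (cases "s > 0")
  case True
  have "(\<lambda>k. exp (- (inverse s * inverse (real k)))) \<longlonglongrightarrow> exp (- (inverse s * 0))"
    by (intro tendsto_intros LIMSEQ_inverse_real_of_nat lim_inverse_n)
  moreover have "\<forall>\<^sub>F k in sequentially. exp (- (inverse s * inverse (real k))) = flat 0 (real k * s)"
    using eventually_gt_at_top[of 0]
    by eventually_elim (use True in \<open>auto simp: flat_def field_simps\<close>)
  ultimately show ?thesis
    using True by (auto intro: Lim_transform_eventually)
qed (simp add: flat_nonpos_eq mult_nonneg_nonpos)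

subsection \<open>Square-integrable functions and integration by parts\<close>

text \<open>Expand the square of \<open>\<bar>s\<bar> - r * \<bar>t\<bar>\<close>. After
  integration, the free weight \<open>r\<close> does the work of the Cauchy-Schwarz
  inequality.\<close>

lemma young_abs:
  fixes r s t :: real
  assumes "r > 0"
  shows "2 * \<bar>s * t\<bar> \<le> s\<^sup>2 / r + r * t\<^sup>2"
proof -
  have "0 \<le> (\<bar>s\<bar> - r * \<bar>t\<bar>)\<^sup>2 / r" using assms by simp
  also have "\<dots> = s\<^sup>2 / r + r * t\<^sup>2 - 2 * \<bar>s * t\<bar>"
    using assms by (simp add: power2_diff power_mult_distrib abs_mult field_simps power2_eq_square)
  finally show ?thesis by simp
qed

lemma integrable_mult_square_integrable:
  fixes f g :: "'a \<Rightarrow> real"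
  assumes [measurable]: "f \<in> borel_measurable M" "g \<in> borel_measurable M"
    and fg: "integrable M (\<lambda>x. (f x)\<^sup>2)" "integrable M (\<lambda>x. (g x)\<^sup>2)"
  shows "integrable M (\<lambda>x. f x * g x)"
proof (rule Bochner_Integration.integrable_bound)
  show "integrable M (\<lambda>x. (f x)\<^sup>2 + (g x)\<^sup>2)" using fg by simp
  show "AE x in M. norm (f x * g x) \<le> norm ((f x)\<^sup>2 + (g x)\<^sup>2)"
  proof (rule AE_I2)
    fix x
    have "\<bar>f x * g x\<bar> \<le> (f x)\<^sup>2 + (g x)\<^sup>2"
      using young_abs[of 1 "f x" "g x"] abs_ge_zero[of "f x * g x"] unfolding div_by_1 mult_1_left by linarith
    then show "norm (f x * g x) \<le> norm ((f x)\<^sup>2 + (g x)\<^sup>2)" by simp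
  qed
qed simp

lemma integral_mult_tendsto_0:
  fixes X :: "nat \<Rightarrow> 'a \<Rightarrow> real"
  assumes [measurable]: "\<And>n. X n \<in> borel_measurable M" "Y \<in> borel_measurable M"
    and X: "\<And>n. integrable M (\<lambda>x. (X n x)\<^sup>2)" and Y: "integrable M (\<lambda>x. (Y x)\<^sup>2)"
    and lim: "(\<lambda>n. LINT x|M. (X n x)\<^sup>2) \<longlonglongrightarrow> 0"
  shows "(\<lambda>n. LINT x|M. \<bar>X n x * Y x\<bar>) \<longlonglongrightarrow> 0"
proof -
  have int: "integrable M (\<lambda>x. X n x * Y x)" for n
    by (rule integrable_mult_square_integrable[OF _ _ X Y]) simp_all
  \<comment> \<open>The weight is slightly larger than the norm of \<open>X n\<close>: the added
    \<open>1 / real (Suc n)\<close> allows division by it even when that norm is zero, and it still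
    tends to \<open>0\<close>.\<close>
  define r where "r n = sqrt ((LINT x|M. (X n x)\<^sup>2) + 1 / real (Suc n))" for n
  have r: "r n > 0" "(LINT x|M. (X n x)\<^sup>2) \<le> r n * r n" for n
    by (auto simp: r_def add_nonneg_pos)
  have "2 * (LINT x|M. \<bar>X n x * Y x\<bar>) \<le> (1 + (LINT x|M. (Y x)\<^sup>2)) * r n" for n
  proof -
    have "2 * (LINT x|M. \<bar>X n x * Y x\<bar>) = (LINT x|M. 2 * \<bar>X n x * Y x\<bar>)" by simp
    also have "\<dots> \<le> (LINT x|M. (X n x)\<^sup>2 / r n + r n * (Y x)\<^sup>2)"
      using young_abs[OF r(1)] X Y int by (intro integral_mono) auto
    also have "\<dots> = (LINT x|M. (X n x)\<^sup>2) / r n + r n * (LINT x|M. (Y x)\<^sup>2)"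
      using X Y by simp
    also have "(LINT x|M. (X n x)\<^sup>2) / r n \<le> r n"
      using r[of n] by (simp add: divide_le_eq)
    finally show ?thesis by (simp add: algebra_simps)
  qed
  then have "(LINT x|M. \<bar>X n x * Y x\<bar>) \<le> (1 + (LINT x|M. (Y x)\<^sup>2)) * r n / 2" for n
    by (simp add: mult.commute)
  then have bound: "\<bar>LINT x|M. \<bar>X n x * Y x\<bar>\<bar> \<le> (1 + (LINT x|M. (Y x)\<^sup>2)) * r n / 2" for n
    by (subst abs_of_nonneg) (auto intro: Bochner_Integration.integral_nonneg)
  have "(\<lambda>n. sqrt ((LINT x|M. (X n x)\<^sup>2) + 1 / real (Suc n))) \<longlonglongrightarrow> sqrt (0 + 0)"
    by (intro tendsto_intros lim LIMSEQ_Suc[OF lim_1_over_n])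
  then have "r \<longlonglongrightarrow> 0" by (simp add: r_def[abs_def])
  then have "(\<lambda>n. (1 + (LINT x|M. (Y x)\<^sup>2)) * r n / 2) \<longlonglongrightarrow> 0"
    using tendsto_mult[OF tendsto_const[of "(1 + (LINT x|M. (Y x)\<^sup>2)) / 2"], of r 0] by simp
  then show "(\<lambda>n. LINT x|M. \<bar>X n x * Y x\<bar>) \<longlonglongrightarrow> 0"
    by (rule Lim_null_comparison[rotated]) (use bound in auto)
qed

text \<open>By translation invariance the difference quotients of \<open>F\<close> in direction
  \<open>e\<close> have integral zero; dominated convergence passes this on to the
  derivative.\<close>

lemma lborel_integral_directional_derivative_eq_0:
  fixes F :: "'a::euclidean_space \<Rightarrow> real"
  assumes F: "\<And>x. (F has_derivative D x) (at x)" and cont: "continuous_on UNIV (\<lambda>x. D x e)"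
    and supp: "bounded {x. F x \<noteq> 0}"
  shows "(LINT x|lborel. D x e) = 0"
proof -
  obtain R where R: "\<And>x. F x \<noteq> 0 \<Longrightarrow> norm x \<le> R" and "R > 0"
    using supp unfolding bounded_pos by auto
  \<comment> \<open>Outside \<open>S\<close> every difference quotient with step at most
    \<open>1\<close> vanishes. The larger radius used for \<open>B\<close> covers all segments from
    a point \<open>x\<close> of \<open>S\<close> to \<open>x + t *\<^sub>R e\<close> with
    \<open>t \<le> 1\<close>.\<close>
  define S where "S = cball (0::'a) (R + norm e)"
  have "bounded ((\<lambda>x. D x e) ` cball 0 (R + 2 * norm e))"
    by (intro compact_imp_bounded compact_continuous_image continuous_on_subset[OF cont]) auto
  then obtain B where "\<forall>y\<in>(\<lambda>x. D x e) ` cball 0 (R + 2 * norm e). norm y \<le> B"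
    unfolding bounded_iff by blast
  then have B: "\<bar>D x e\<bar> \<le> B" if "norm x \<le> R + 2 * norm e" for x
    using that by simp
  define q where "q k x = real (Suc k) * (F (x + (1 / real (Suc k)) *\<^sub>R e) - F x)" for k x
  have contF: "continuous_on UNIV F"
    using F has_derivative_continuous_on has_derivative_at_withinI by blast
  have [measurable]: "F \<in> borel_measurable borel" "(\<lambda>x. D x e) \<in> borel_measurable borel"
    using contF cont by (auto intro: borel_measurable_continuous_onI)
  have q_lim: "(\<lambda>k. q k x) \<longlonglongrightarrow> D x e" for x
  proof -
    have "((\<lambda>t. x + t *\<^sub>R e) has_derivative (\<lambda>t. t *\<^sub>R e)) (at 0)"
      by (auto intro!: derivative_eq_intros)
    moreover have "(F has_derivative D x) (at (x + 0 *\<^sub>R e))" using F by simp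
    ultimately have "((\<lambda>t. F (x + t *\<^sub>R e)) has_derivative (\<lambda>t. D x (t *\<^sub>R e))) (at 0)"
      by (rule has_derivative_compose)
    moreover have "D x (t *\<^sub>R e) = D x e * t" for t
      using linear_scale[OF has_derivative_linear[OF F], of x t e] by (simp add: mult.commute)
    ultimately have "((\<lambda>t. F (x + t *\<^sub>R e)) has_real_derivative D x e) (at 0)"
      by (simp add: has_field_derivative_def)
    then have "((\<lambda>t. (F (x + t *\<^sub>R e) - F x) / t) \<longlongrightarrow> D x e) (at 0)"
      by (simp add: DERIV_def)
    moreover have "filterlim (\<lambda>k. 1 / real (Suc k)) (at 0) sequentially"
      by (intro filterlim_atI LIMSEQ_Suc[OF lim_1_over_n]) auto
    ultimately have "(\<lambda>k. (F (x + (1 / real (Suc k)) *\<^sub>R e) - F x) / (1 / real (Suc k))) \<longlonglongrightarrow> D x e"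
      by (rule filterlim_compose)
    then show ?thesis by (simp add: q_def mult.commute)
  qed
  have q_bound: "\<bar>q k x\<bar> \<le> B * indicator S x" for k x
  proof (cases "x \<in> S")
    case True
    define t where "t = 1 / real (Suc k)"
    have t: "0 < t" "t \<le> 1" by (auto simp: t_def)
    have *: "\<bar>D y e\<bar> \<le> B" if "y \<in> closed_segment x (x + t *\<^sub>R e)" for y
    proof -
      have "\<exists>s. 0 \<le> s \<and> s \<le> 1 \<and> y = (1 - s) *\<^sub>R x + s *\<^sub>R (x + t *\<^sub>R e)"
        using that by (simp add: in_segment)
      then obtain s where s: "0 \<le> s" "s \<le> 1" "y = (1 - s) *\<^sub>R x + s *\<^sub>R (x + t *\<^sub>R e)"
        by (elim exE conjE)
      have "y = x + (s * t) *\<^sub>R e" using s(3) by (simp add: algebra_simps)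
      then have "norm y \<le> norm x + norm ((s * t) *\<^sub>R e)"
        by (simp only: norm_triangle_ineq)
      also have "norm ((s * t) *\<^sub>R e) = s * t * norm e"
        using s t by simp
      also have "s * t * norm e \<le> 1 * norm e"
        using s t by (intro mult_right_mono mult_le_one) auto
      finally show ?thesis using True by (intro B) (auto simp: S_def)
    qed
    \<comment> \<open>The mean value theorem along the segment replaces the difference quotient by a
      value of the derivative, which \<open>B\<close> bounds.\<close>
    have "\<exists>s. 0 < s \<and> s < t \<and> F (x + t *\<^sub>R e) - F (x + 0 *\<^sub>R e) = (t - 0) * D (x + s *\<^sub>R e) e"
    proof (rule MVT2[OF t(1), of "\<lambda>t. F (x + t *\<^sub>R e)" "\<lambda>s. D (x + s *\<^sub>R e) e"])
      fix s
      have "((\<lambda>t. x + t *\<^sub>R e) has_derivative (\<lambda>t. t *\<^sub>R e)) (at s)"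
        by (auto intro!: derivative_eq_intros)
      from has_derivative_compose[OF this F]
      have "((\<lambda>t. F (x + t *\<^sub>R e)) has_derivative (\<lambda>t. D (x + s *\<^sub>R e) (t *\<^sub>R e))) (at s)" .
      moreover have "D y (t *\<^sub>R e) = D y e * t" for t y
        using linear_scale[OF has_derivative_linear[OF F], of y t e] by (simp add: mult.commute)
      ultimately show "((\<lambda>t. F (x + t *\<^sub>R e)) has_real_derivative D (x + s *\<^sub>R e) e) (at s)"
        by (simp add: has_field_derivative_def)
    qed
    then obtain s where s: "0 < s" "s < t" "F (x + t *\<^sub>R e) - F (x + 0 *\<^sub>R e) = (t - 0) * D (x + s *\<^sub>R e) e"
      by (elim exE conjE)
    have "x + s *\<^sub>R e = (1 - s / t) *\<^sub>R x + (s / t) *\<^sub>R (x + t *\<^sub>R e)"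
      using t by (simp add: algebra_simps)
    then have "x + s *\<^sub>R e \<in> closed_segment x (x + t *\<^sub>R e)"
      using s(1,2) t unfolding in_segment by (intro exI[of _ "s / t"] conjI) simp_all
    from *[OF this] show ?thesis
      using True s(3) by (simp add: q_def t_def)
  next
    case False
    have nx: "norm x \<le> norm (x + t *\<^sub>R e) + norm e" if "0 < t" "t \<le> 1" for t
    proof -
      have "norm x \<le> norm (x + t *\<^sub>R e) + t * norm e"
        using that norm_triangle_ineq4[of "x + t *\<^sub>R e" "t *\<^sub>R e"] by simp
      moreover have "t * norm e \<le> 1 * norm e"
        using that by (intro mult_right_mono) auto
      ultimately show ?thesis by linarith
    qed
    have "norm x \<le> norm (x + (1 / real (Suc k)) *\<^sub>R e) + norm e"
      by (rule nx) auto
    moreover have "norm x > R + norm e" using False by (simp add: S_def)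
    ultimately have "\<not> norm x \<le> R" "\<not> norm (x + (1 / real (Suc k)) *\<^sub>R e) \<le> R"
      using norm_ge_zero[of e] by linarith+
    then have "F x = 0" "F (x + (1 / real (Suc k)) *\<^sub>R e) = 0"
      using R by blast+
    then show ?thesis using False by (simp add: q_def)
  qed
  have "integrable lborel (indicator S :: 'a \<Rightarrow> real)"
    unfolding S_def by (rule integrable_real_indicator) (use emeasure_lborel_cball_finite in auto)
  then have S: "integrable lborel (\<lambda>x. B * indicator S x)" by simp
  have "integrable lborel (\<lambda>x. indicator (cball 0 R) x *\<^sub>R F x)"
    by (rule borel_integrable_compact[OF compact_cball continuous_on_subset[OF contF subset_UNIV]])
  moreover have "indicator (cball 0 R) x *\<^sub>R F x = F x" for x
    using R[of x] by (cases "F x = 0") (simp_all add: mem_cball)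
  ultimately have F_int: "integrable lborel F" by (simp only:)
  \<comment> \<open>Translating by \<open>v\<close> leaves Lebesgue measure unchanged, so the two
    integrals in the quotient cancel.\<close>
  have "(LINT x|lborel. q k x) = 0" for k
  proof -
    define v where "v = (1 / real (Suc k)) *\<^sub>R e"
    have "integrable (distr lborel borel ((+) v)) F"
      using F_int by (simp only: lborel_distr_plus)
    then have 1: "integrable lborel (\<lambda>x. F (x + v))"
      by (subst (asm) integrable_distr_eq) (simp_all add: add.commute)
    have "(LINT x|lborel. F x) = (LINT x|distr lborel borel ((+) v). F x)"
      by (simp only: lborel_distr_plus)
    also have "\<dots> = (LINT x|lborel. F (x + v))"
      by (subst integral_distr) (simp_all add: add.commute)
    finally have 2: "(LINT x|lborel. F (x + v)) - (LINT x|lborel. F x) = 0" by simp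
    have "(LINT x|lborel. q k x) = real (Suc k) * ((LINT x|lborel. F (x + v)) - (LINT x|lborel. F x))"
      unfolding q_def v_def[symmetric] using F_int 1 by (simp del: of_nat_Suc)
    then show ?thesis unfolding 2 by simp
  qed
  moreover have "(\<lambda>k. LINT x|lborel. q k x) \<longlonglongrightarrow> (LINT x|lborel. D x e)"
  proof (rule integral_dominated_convergence[OF _ _ S])
    show "(\<lambda>x. D x e) \<in> borel_measurable lborel" by simp
    show "q k \<in> borel_measurable lborel" for k unfolding q_def by measurable
    show "AE x in lborel. (\<lambda>k. q k x) \<longlonglongrightarrow> D x e" using q_lim by simp
    show "AE x in lborel. norm (q k x) \<le> B * indicator S x" for k using q_bound by simp
  qed
  ultimately show ?thesis by (simp add: LIMSEQ_const_iff)
qed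

lemma integrable_lebesgue_on_continuous:
  fixes f :: "'a::euclidean_space \<Rightarrow> 'b::{banach, second_countable_topology}"
  assumes "open \<Omega>" "bounded \<Omega>" "continuous_on UNIV f"
  shows "integrable (lebesgue_on \<Omega>) f"
proof -
  interpret finite_measure "lebesgue_on \<Omega>"
    using assms(1,2) by (rule finite_measure_lebesgue_on[OF lmeasurable_open, rotated])
  have "bounded (f ` closure \<Omega>)"
    using assms(2) continuous_on_subset[OF assms(3) subset_UNIV]
    by (intro compact_imp_bounded compact_continuous_image) auto
  then obtain B where "\<forall>y\<in>f ` closure \<Omega>. norm y \<le> B"
    unfolding bounded_iff by blast
  then have B: "norm (f x) \<le> B" if "x \<in> \<Omega>" for x
    using that closure_subset by blast
  have "f \<in> borel_measurable lebesgue"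
    using assms(3) by (intro measurable_completion) (simp add: borel_measurable_continuous_onI)
  then show ?thesis
    using B by (intro integrable_const_bound[where B = B] measurable_restrict_space1 AE_I2) auto
qed

lemma lebesgue_on_integral_eq_lborel:
  fixes f :: "'a::euclidean_space \<Rightarrow> 'b::{banach, second_countable_topology}"
  assumes "open \<Omega>" "continuous_on UNIV f" "\<And>x. x \<notin> \<Omega> \<Longrightarrow> f x = 0"
  shows "(LINT x|lebesgue_on \<Omega>. f x) = (LINT x|lborel. f x)"
proof -
  have "indicator \<Omega> x *\<^sub>R f x = f x" for x
    using assms(3) by (cases "x \<in> \<Omega>") auto
  then show ?thesis
    using assms by (simp add: integral_restrict_space integral_completion borel_measurable_continuous_onI)
qed

section \<open>Test functions and their classical gradients\<close>

lemma test_functionsI: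
  assumes "smooth f" "{x. f x \<noteq> 0} \<subseteq> K" "compact K" "K \<subseteq> \<Omega>"
  shows "f \<in> test_functions \<Omega>"
proof -
  have "closure {x. f x \<noteq> 0} \<subseteq> K"
    using assms by (intro closure_minimal compact_imp_closed)
  moreover have "bounded {x. f x \<noteq> 0}"
    using assms bounded_subset compact_imp_bounded by blast
  ultimately show ?thesis
    using assms unfolding test_functions_def smooth_def by (auto simp: compact_closure)
qed

lemma test_functionsD:
  assumes "f \<in> test_functions \<Omega>"
  shows "smooth f" "compact (closure {x. f x \<noteq> 0})" "closure {x. f x \<noteq> 0} \<subseteq> \<Omega>"
  using assms by (auto simp: test_functions_def smooth_def)

lemma test_functions_mult:
  assumes "f \<in> test_functions \<Omega>" "smooth g"
  shows "(\<lambda>x. f x * g x) \<in> test_functions \<Omega>"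
  using test_functionsD[OF assms(1)] assms(2) closure_subset
  by (intro test_functionsI[where K = "closure {x. f x \<noteq> 0}"] smooth_mult) fastforce+

lemma grad_nth: "grad f x $ i = frechet_derivative f (at x) (axis i 1)"
  by (simp add: grad_def)

lemma smooth_grad_nth: "smooth f \<Longrightarrow> smooth (\<lambda>x. grad f x $ i)"
  by (simp add: grad_nth smooth_frechet_derivative axis_in_Basis_iff)

lemma continuous_on_grad: "smooth f \<Longrightarrow> continuous_on S (grad f)"
  using smooth_continuous_on[OF smooth_grad_nth]
  by (auto simp: continuous_on_componentwise[of S "grad f"] Basis_vec_def cart_eq_inner_axis[symmetric])

lemma grad_mult:
  "smooth f \<Longrightarrow> smooth g \<Longrightarrow> grad (\<lambda>x. f x * g x) x = f x *\<^sub>R grad g x + g x *\<^sub>R grad f x"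
  using frechet_derivative_at[OF has_derivative_mult[OF smooth_has_derivative[of f] smooth_has_derivative[of g]], of x]
  by (auto simp: vec_eq_iff grad_nth fun_eq_iff mult.commute)

text \<open>Off the closed support the function vanishes on an open set, so its derivative vanishes
  there too.\<close>

lemma test_function_grad_nth:
  assumes "f \<in> test_functions \<Omega>" shows "(\<lambda>x. grad f x $ i) \<in> test_functions \<Omega>"
proof (rule test_functionsI)
  let ?K = "closure {x. f x \<noteq> 0}"
  show "smooth (\<lambda>x. grad f x $ i)" "compact ?K" "?K \<subseteq> \<Omega>"
    using test_functionsD[OF assms] by (auto intro: smooth_grad_nth)
  have "grad f x $ i = 0" if "x \<notin> ?K" for x
  proof -
    have "((\<lambda>_. 0) has_derivative (\<lambda>_. 0)) (at x)" by simp
    then have "(f has_derivative (\<lambda>_. 0)) (at x)"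
      by (rule has_derivative_transform_within_open[of _ _ _ _ "- ?K"])
        (use that closure_subset in \<open>force+\<close>)
    from frechet_derivative_at[OF this] show ?thesis by (simp add: grad_nth fun_eq_iff)
  qed
  then show "{x. grad f x $ i \<noteq> 0} \<subseteq> ?K" by blast
qed

text \<open>The product \<open>f * \<phi>\<close> inherits compact support from
  \<open>\<phi>\<close>, so its partial derivatives integrate to zero. As \<open>f\<close> carries
  no boundary condition, it may be a barrier.\<close>

lemma test_function_integration_by_parts:
  fixes \<Omega> :: "(real^'n) set"
  assumes "open \<Omega>" "bounded \<Omega>" "smooth f" "\<phi> \<in> test_functions \<Omega>"
  shows "(LINT x|lebesgue_on \<Omega>. f x * grad \<phi> x $ i) = - (LINT x|lebesgue_on \<Omega>. grad f x $ i * \<phi> x)"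
proof -
  note \<phi> = test_functionsD[OF assms(4)]
  define F where "F = (\<lambda>x. f x * \<phi> x)"
  have F: "smooth F" using assms(3) \<phi>(1) by (simp add: F_def smooth_mult)
  have gF: "grad F x $ i = f x * grad \<phi> x $ i + grad f x $ i * \<phi> x" for x
    using grad_mult[OF assms(3) \<phi>(1)] by (simp add: F_def)
  have tF: "F \<in> test_functions \<Omega>"
    using test_functions_mult[OF assms(4,3)] by (simp add: F_def mult.commute)
  have "(LINT x|lborel. grad F x $ i) = 0"
    unfolding grad_nth
  proof (rule lborel_integral_directional_derivative_eq_0[OF smooth_has_derivative[OF F]])
    show "continuous_on UNIV (\<lambda>x. frechet_derivative F (at x) (axis i 1))"
      using smooth_continuous_on[OF smooth_grad_nth[OF F]] by (simp add: grad_nth)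
    show "bounded {x. F x \<noteq> 0}"
      using bounded_subset[OF compact_imp_bounded closure_subset] test_functionsD(2)[OF tF] by blast
  qed
  moreover have "(LINT x|lebesgue_on \<Omega>. grad F x $ i) = (LINT x|lborel. grad F x $ i)"
    using test_functionsD[OF test_function_grad_nth[OF tF, of i]] assms(1)
      closure_subset[of "{x. grad F x $ i \<noteq> 0}"]
    by (intro lebesgue_on_integral_eq_lborel smooth_continuous_on) auto
  ultimately have "0 = (LINT x|lebesgue_on \<Omega>. f x * grad \<phi> x $ i + grad f x $ i * \<phi> x)"
    by (simp add: gF)
  also have "\<dots> = (LINT x|lebesgue_on \<Omega>. f x * grad \<phi> x $ i) + (LINT x|lebesgue_on \<Omega>. grad f x $ i * \<phi> x)"
    using assms(3) \<phi>(1)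
    by (intro Bochner_Integration.integral_add integrable_lebesgue_on_continuous[OF assms(1,2)] smooth_continuous_on
        smooth_mult smooth_grad_nth)
  finally show ?thesis by simp
qed

subsection \<open>The fundamental lemma of the calculus of variations\<close>

text \<open>The factors for coordinate \<open>i\<close> are both positive exactly when
  \<open>x \<bullet> i\<close> lies strictly between \<open>a \<bullet> i\<close> and
  \<open>b \<bullet> i\<close>, so the product is positive precisely on the open box.\<close>

definition bump :: "'a::euclidean_space \<Rightarrow> 'a \<Rightarrow> 'a \<Rightarrow> real" where
  "bump a b x = (\<Prod>i\<in>Basis. flat 0 (x \<bullet> i - a \<bullet> i) * flat 0 (b \<bullet> i - x \<bullet> i))"

lemma smooth_bump: "smooth (bump a b)"
  unfolding bump_def[abs_def]
  by (intro smooth_prod smooth_mult smooth_comp[OF smooth_flat] smooth_diff smooth_inner smooth_const)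

lemma bump_pos: "x \<in> box a b \<Longrightarrow> 0 < bump a b x"
  by (auto simp: bump_def mem_box intro!: prod_pos mult_pos_pos flat_pos)

lemma bump_eq_0: "x \<notin> box a b \<Longrightarrow> bump a b x = 0"
  by (force simp: bump_def mem_box not_less intro!: prod_zero bexI flat_nonpos_eq)

lemma bump_in_test_functions:
  assumes "cbox a b \<subseteq> \<Omega>" shows "bump a b \<in> test_functions \<Omega>"
  by (rule test_functionsI[OF smooth_bump _ compact_cbox assms])
    (use bump_eq_0 box_subset_cbox in blast)

lemma integrable_test_function_mult:
  fixes f :: "real^'n \<Rightarrow> real"
  assumes "integrable (lebesgue_on \<Omega>) f" "\<psi> \<in> test_functions \<Omega>"
  shows "integrable (lebesgue_on \<Omega>) (\<lambda>x. \<psi> x * f x)"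
proof -
  note \<psi> = test_functionsD[OF assms(2)]
  let ?K = "closure {x. \<psi> x \<noteq> 0}"
  have "bounded (\<psi> ` ?K)"
    using \<psi> by (intro compact_imp_bounded compact_continuous_image smooth_continuous_on)
  then obtain B where B: "\<forall>y\<in>\<psi> ` ?K. norm y \<le> B"
    unfolding bounded_iff by blast
  have bound: "\<bar>\<psi> x\<bar> \<le> \<bar>B\<bar>" for x
  proof (cases "\<psi> x = 0")
    case False
    then have "x \<in> ?K" using closure_subset[of "{x. \<psi> x \<noteq> 0}"] by auto
    then have "norm (\<psi> x) \<le> B" using B by blast
    then show ?thesis by simp
  qed simp
  have [measurable]: "f \<in> borel_measurable (lebesgue_on \<Omega>)" using assms(1) by simp
  have [measurable]: "\<psi> \<in> borel_measurable (lebesgue_on \<Omega>)"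
    using smooth_continuous_on[OF \<psi>(1)]
    by (intro measurable_restrict_space1 measurable_completion) (simp add: borel_measurable_continuous_onI)
  show ?thesis
  proof (rule Bochner_Integration.integrable_bound)
    show "integrable (lebesgue_on \<Omega>) (\<lambda>x. \<bar>B\<bar> * f x)" using assms(1) by simp
    show "AE x in lebesgue_on \<Omega>. norm (\<psi> x * f x) \<le> norm (\<bar>B\<bar> * f x)"
      using bound by (auto simp: abs_mult intro!: mult_right_mono)
  qed measurable
qed

text \<open>Multiply \<open>f\<close> by a fixed test function. Smooth approximations of indicators
  show that the product has integral zero over boxes, hence over Borel and then over Lebesgue sets,
  so it vanishes almost everywhere. Bumps on countably many boxes remove the factor.\<close>

lemma fundamental_lemma_calculus_of_variations:
  fixes \<Omega> :: "(real^'n) set" and f :: "real^'n \<Rightarrow> real"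
  assumes "open \<Omega>" and f: "integrable (lebesgue_on \<Omega>) f"
    and orth: "\<And>\<psi>. \<psi> \<in> test_functions \<Omega> \<Longrightarrow> (LINT x|lebesgue_on \<Omega>. \<psi> x * f x) = 0"
  shows "AE x in lebesgue_on \<Omega>. f x = 0"
proof -
  have \<Omega>: "\<Omega> \<in> sets lebesgue" using assms(1) by auto
  have null: "AE x in lebesgue. x \<in> \<Omega> \<longrightarrow> \<psi> x * f x = 0" if \<psi>: "\<psi> \<in> test_functions \<Omega>" for \<psi>
  proof -
    \<comment> \<open>After this cut-off \<open>h\<close> is integrable on the whole space, and
      \<open>\<psi> * \<eta>\<close> is a test function for every smooth \<open>\<eta>\<close>;
      hence the boxes tested below may leave \<open>\<Omega>\<close>.\<close>
    define h where "h x = (if x \<in> \<Omega> then \<psi> x * f x else 0)" for x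
    have h: "integrable lebesgue h"
      unfolding h_def[abs_def] Lebesgue_Measure.integrable_restrict_UNIV[OF \<Omega>]
      by (rule integrable_test_function_mult[OF f \<psi>])
    then have hA: "set_integrable lebesgue A h" if "A \<in> sets lebesgue" for A
      using that unfolding set_integrable_def by (rule integrable_mult_indicator[rotated])
    have test_h: "(LINT x|lebesgue. \<eta> x * h x) = 0" if "smooth \<eta>" for \<eta>
    proof -
      have "(LINT x|lebesgue. \<eta> x * h x) = (LINT x|lebesgue. (if x \<in> \<Omega> then (\<psi> x * \<eta> x) * f x else 0))"
        by (intro Bochner_Integration.integral_cong) (auto simp: h_def)
      also have "\<dots> = (LINT x|lebesgue_on \<Omega>. (\<psi> x * \<eta> x) * f x)"
        by (rule Lebesgue_Measure.integral_restrict_UNIV[OF \<Omega>])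
      finally show ?thesis using orth[OF test_functions_mult[OF \<psi> that]] by simp
    qed
    have gen: "sets borel = sigma_sets UNIV (range (\<lambda>(a, b). box a b :: (real^'n) set))"
      by (subst borel_eq_box) simp
    have "(LINT x:A|lebesgue. h x) = 0" if "A \<in> sets borel" for A
    proof -
      \<comment> \<open>Boxes are stable under intersection and generate the Borel sets, so the
        property spreads from boxes through complements and countable disjoint unions.\<close>
      have "Int_stable (range (\<lambda>(a, b). box a b :: (real^'n) set))"
        by (auto simp: Int_stable_def box_Int_box)
      moreover have "range (\<lambda>(a, b). box a b :: (real^'n) set) \<subseteq> Pow UNIV" by simp
      moreover have "A \<in> sigma_sets UNIV (range (\<lambda>(a, b). box a b :: (real^'n) set))"
        using that gen by blast
      ultimately show ?thesis
      proof (induction rule: sigma_sets_induct_disjoint)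
        case (basic A)
        then obtain a b where A: "A = box a b" by auto
        have "(\<lambda>k. LINT x|lebesgue. flat 0 (real k * bump a b x) * h x) \<longlonglongrightarrow>
            (LINT x|lebesgue. indicator (box a b) x * h x)"
        proof (rule integral_dominated_convergence)
          show "integrable lebesgue (\<lambda>x. norm (h x))" using h by simp
          show "AE x in lebesgue. (\<lambda>k. flat 0 (real k * bump a b x) * h x) \<longlonglongrightarrow> indicator (box a b) x * h x"
          proof (intro AE_I2 tendsto_mult tendsto_const)
            fix x
            have "(if bump a b x > 0 then 1 else 0) = (indicator (box a b) x :: real)"
              using bump_pos[of x a b] bump_eq_0[of x a b] by (cases "x \<in> box a b") auto
            then show "(\<lambda>k. flat 0 (real k * bump a b x)) \<longlonglongrightarrow> indicator (box a b) x"
              using flat_zero_scale_tendsto[of "bump a b x"] by simp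
          qed
          show "AE x in lebesgue. norm (flat 0 (real k * bump a b x) * h x) \<le> norm (h x)" for k
            using flat_zero_le flat_nonneg by (auto simp: abs_mult intro!: mult_left_le_one_le)
          have hm: "h \<in> borel_measurable lebesgue" using h by (rule borel_measurable_integrable)
          then show "(\<lambda>x. indicator (box a b) x * h x) \<in> borel_measurable lebesgue"
            by (intro borel_measurable_times borel_measurable_indicator) simp_all
          have "(\<lambda>x. flat 0 (real k * bump a b x)) \<in> borel_measurable lebesgue" for k
            by (intro measurable_completion) (simp add: borel_measurable_continuous_onI smooth_continuous_on
                smooth_comp[OF smooth_flat] smooth_mult smooth_const smooth_bump)
          then show "(\<lambda>x. flat 0 (real k * bump a b x) * h x) \<in> borel_measurable lebesgue" for k
            using hm by (intro borel_measurable_times) simp_all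
        qed
        moreover have "(LINT x|lebesgue. flat 0 (real k * bump a b x) * h x) = 0" for k
          by (intro test_h smooth_comp[OF smooth_flat] smooth_mult smooth_const smooth_bump)
        ultimately show ?case
          by (simp add: LIMSEQ_const_iff set_lebesgue_integral_def A)
      next
        case empty
        show ?case by (simp add: set_lebesgue_integral_def)
      next
        case (compl A)
        then have A: "A \<in> sets lebesgue" using gen by auto
        have "(LINT x:UNIV - A|lebesgue. h x) = (LINT x|lebesgue. h x - indicator A x * h x)"
          unfolding set_lebesgue_integral_def
          by (intro Bochner_Integration.integral_cong) (auto simp: indicator_def)
        also have "\<dots> = (LINT x|lebesgue. h x) - (LINT x:A|lebesgue. h x)"
          using h hA[OF A] unfolding set_lebesgue_integral_def set_integrable_def by simp
        \<comment> \<open>Taking \<open>\<eta> = 1\<close> shows that the integral over the whole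
          space vanishes.\<close>
        finally show ?case using compl test_h[OF smooth_const[of 1]] by simp
      next
        case (union A)
        have A: "A i \<in> sets lebesgue" for i
        proof -
          have "A i \<in> sets borel" unfolding gen using union(2) by blast
          then show ?thesis by simp
        qed
        then have "(LINT x:(\<Union>i. A i)|lebesgue. h x) = (\<Sum>i. (LINT x:(A i)|lebesgue. h x))"
          using union by (intro lebesgue_integral_countable_add hA) (auto simp: disjoint_family_on_def)
        then show ?case using union by simp
      qed
    qed
    then have "(LINT x:A|lebesgue. h x) = 0" if "A \<in> sets lebesgue" for A
    proof -
      \<comment> \<open>A Lebesgue set differs from a Borel set only inside a Borel null set, which
        the integral ignores.\<close>
      obtain S N N' where A: "A = S \<union> N" "N \<subseteq> N'" "N' \<in> null_sets lborel" "S \<in> sets lborel"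
        using \<open>A \<in> sets lebesgue\<close> by (rule sets_completionE)
      have "AE x in lebesgue. x \<notin> N'"
        using A(3) by (intro AE_completion AE_not_in)
      then have "AE x in lebesgue. indicator A x *\<^sub>R h x = indicator S x *\<^sub>R h x"
        by eventually_elim (use A in \<open>auto simp: indicator_def\<close>)
      then have "(LINT x:A|lebesgue. h x) = (LINT x:S|lebesgue. h x)"
        unfolding set_lebesgue_integral_def
        using hA[OF that] hA[of S] A(4) by (intro integral_cong_AE) (auto simp: set_integrable_def)
      then show ?thesis using \<open>\<And>A. A \<in> sets borel \<Longrightarrow> (LINT x:A|lebesgue. h x) = 0\<close> A(4) by simp
    qed
    then have "AE x in lebesgue. h x = 0"
      by (intro density_unique_real h) (simp_all add: set_lebesgue_integral_def)
    then show ?thesis by eventually_elim (auto simp: h_def)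
  qed
  \<comment> \<open>Open boxes with closed box inside \<open>\<Omega>\<close> cover
    \<open>\<Omega>\<close>, and Lindelof leaves countably many. On each of them the bump is
    positive and can be divided out.\<close>
  define F where "F = {(a, b) | a b. cbox a b \<subseteq> \<Omega>}"
  obtain C where C: "C \<subseteq> (\<lambda>(a, b). box a b) ` F" "countable C" "\<Union>C = \<Union>((\<lambda>(a, b). box a b) ` F)"
    by (rule Lindelof[of "(\<lambda>(a, b). box a b) ` F"]) auto
  have "\<forall>U\<in>C. AE x in lebesgue. x \<in> U \<longrightarrow> f x = 0"
  proof
    fix U assume "U \<in> C"
    then obtain a b where U: "U = box a b" "cbox a b \<subseteq> \<Omega>" using C(1) by (auto simp: F_def)
    from null[OF bump_in_test_functions[OF U(2)]] show "AE x in lebesgue. x \<in> U \<longrightarrow> f x = 0"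
      by eventually_elim (use U bump_pos[of _ a b] box_subset_cbox[of a b] in force)
  qed
  then have "AE x in lebesgue. \<forall>U\<in>C. x \<in> U \<longrightarrow> f x = 0"
    by (simp only: AE_ball_countable[OF C(2)])
  moreover have "\<Omega> \<subseteq> \<Union>C"
  proof
    fix x assume "x \<in> \<Omega>"
    then obtain a b where "x \<in> box a b" "cbox a b \<subseteq> \<Omega>"
      using open_contains_cbox[OF assms(1)] by metis
    then show "x \<in> \<Union>C" unfolding C(3) F_def by blast
  qed
  ultimately have "AE x in lebesgue. x \<in> \<Omega> \<longrightarrow> f x = 0"
    by (elim eventually_mono) blast
  then show ?thesis using \<Omega> by (simp add: AE_restrict_space_iff)
qed

subsection \<open>Weak gradients of test functions\<close>

lemma integral_vec_nth:
  "integrable M f \<Longrightarrow> (LINT x|M. f x) $ i = (LINT x|M. f x $ i)"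
  by (rule integral_bounded_linear[OF bounded_linear_vec_nth, symmetric])

lemma integrable_vec_nth: "integrable M f \<Longrightarrow> integrable M (\<lambda>x. f x $ i)"
  by (rule integrable_bounded_linear[OF bounded_linear_vec_nth])

lemma L2_continuous:
  fixes f :: "real^'n \<Rightarrow> 'b::euclidean_space"
  assumes "open \<Omega>" "bounded \<Omega>" "continuous_on UNIV f"
  shows "f \<in> L2 \<Omega>"
proof -
  have "continuous_on UNIV (\<lambda>x. (norm (f x))\<^sup>2)"
    using assms(3) by (intro continuous_intros)
  then show ?thesis
    using integrable_lebesgue_on_continuous[OF assms] integrable_lebesgue_on_continuous[OF assms(1,2)]
    by (simp add: L2_def borel_measurable_integrable)
qed

lemma L2_imp_integrable:
  fixes f :: "real^'n \<Rightarrow> 'b::euclidean_space"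
  assumes "open \<Omega>" "bounded \<Omega>" "f \<in> L2 \<Omega>"
  shows "integrable (lebesgue_on \<Omega>) f"
proof -
  interpret finite_measure "lebesgue_on \<Omega>"
    using assms(1,2) by (rule finite_measure_lebesgue_on[OF lmeasurable_open, rotated])
  have f: "f \<in> borel_measurable (lebesgue_on \<Omega>)" "integrable (lebesgue_on \<Omega>) (\<lambda>x. (norm (f x))\<^sup>2)"
    using assms(3) by (simp_all add: L2_def)
  have "integrable (lebesgue_on \<Omega>) (\<lambda>x. norm (f x))"
    by (rule square_integrable_imp_integrable[OF measurable_compose[OF f(1) borel_measurable_norm] f(2)])
  then show ?thesis using f(1) by (simp only: integrable_norm_iff)
qed

lemma L2_diff:
  assumes "f \<in> L2 \<Omega>" "g \<in> L2 \<Omega>" shows "(\<lambda>x. f x - g x) \<in> L2 \<Omega>"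
proof -
  have m: "f \<in> borel_measurable (lebesgue_on \<Omega>)" "g \<in> borel_measurable (lebesgue_on \<Omega>)"
    and i: "integrable (lebesgue_on \<Omega>) (\<lambda>x. (norm (f x))\<^sup>2)" "integrable (lebesgue_on \<Omega>) (\<lambda>x. (norm (g x))\<^sup>2)"
    using assms by (simp_all add: L2_def)
  have "(norm (f x - g x))\<^sup>2 \<le> 2 * (norm (f x))\<^sup>2 + 2 * (norm (g x))\<^sup>2" for x
  proof -
    have "(norm (f x - g x))\<^sup>2 \<le> (norm (f x) + norm (g x))\<^sup>2"
      by (intro power_mono norm_triangle_ineq4) simp
    also have "\<dots> \<le> 2 * (norm (f x))\<^sup>2 + 2 * (norm (g x))\<^sup>2"
      using zero_le_power2[of "norm (f x) - norm (g x)"] by (simp add: power2_sum power2_diff)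
    finally show ?thesis .
  qed
  moreover have "(\<lambda>x. f x - g x) \<in> borel_measurable (lebesgue_on \<Omega>)"
    using m by simp
  moreover have "integrable (lebesgue_on \<Omega>) (\<lambda>x. 2 * (norm (f x))\<^sup>2 + 2 * (norm (g x))\<^sup>2)"
    using i by simp
  ultimately have "integrable (lebesgue_on \<Omega>) (\<lambda>x. (norm (f x - g x))\<^sup>2)"
    by (elim Bochner_Integration.integrable_bound) (simp_all)
  then show ?thesis using m by (simp add: L2_def)
qed

lemma L2_inner_integrable:
  assumes "f \<in> L2 \<Omega>" "g \<in> L2 \<Omega>" shows "integrable (lebesgue_on \<Omega>) (\<lambda>x. f x \<bullet> g x)"
proof -
  have m: "f \<in> borel_measurable (lebesgue_on \<Omega>)" "g \<in> borel_measurable (lebesgue_on \<Omega>)"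
    and i: "integrable (lebesgue_on \<Omega>) (\<lambda>x. (norm (f x))\<^sup>2)" "integrable (lebesgue_on \<Omega>) (\<lambda>x. (norm (g x))\<^sup>2)"
    using assms by (simp_all add: L2_def)
  have "integrable (lebesgue_on \<Omega>) (\<lambda>x. norm (f x) * norm (g x))"
    using m i by (intro integrable_mult_square_integrable) simp_all
  moreover have "(\<lambda>x. f x \<bullet> g x) \<in> borel_measurable (lebesgue_on \<Omega>)"
    using m by simp
  ultimately show ?thesis
    by (rule Bochner_Integration.integrable_bound) (simp add: Cauchy_Schwarz_ineq2)
qed

lemma integrable_test_function_scaleR:
  fixes f :: "real^'n \<Rightarrow> real^'n"
  assumes "integrable (lebesgue_on \<Omega>) f" "\<psi> \<in> test_functions \<Omega>"
  shows "integrable (lebesgue_on \<Omega>) (\<lambda>x. \<psi> x *\<^sub>R f x)"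
proof -
  have "integrable (lebesgue_on \<Omega>) (\<lambda>x. \<psi> x * norm (f x))"
    using assms by (intro integrable_test_function_mult integrable_norm)
  moreover have "\<psi> \<in> borel_measurable (lebesgue_on \<Omega>)"
    using smooth_continuous_on[OF test_functionsD(1)[OF assms(2)]]
    by (intro measurable_restrict_space1 measurable_completion) (simp add: borel_measurable_continuous_onI)
  then have "(\<lambda>x. \<psi> x *\<^sub>R f x) \<in> borel_measurable (lebesgue_on \<Omega>)"
    using assms(1) by (intro borel_measurable_scaleR) simp_all
  ultimately show ?thesis
    by (rule Bochner_Integration.integrable_bound) simp
qed

lemma smooth_has_weak_gradient:
  assumes "open \<Omega>" "bounded \<Omega>" "smooth f"
  shows "has_weak_gradient \<Omega> f (grad f)"
  unfolding has_weak_gradient_def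
proof
  fix \<phi> assume \<phi>: "\<phi> \<in> test_functions \<Omega>"
  note s\<phi> = test_functionsD(1)[OF \<phi>]
  have int: "integrable (lebesgue_on \<Omega>) (\<lambda>x. f x *\<^sub>R grad \<phi> x)" "integrable (lebesgue_on \<Omega>) (\<lambda>x. \<phi> x *\<^sub>R grad f x)"
    using assms s\<phi> by (auto intro!: integrable_lebesgue_on_continuous continuous_on_scaleR
        smooth_continuous_on continuous_on_grad)
  show "(LINT x|lebesgue_on \<Omega>. f x *\<^sub>R grad \<phi> x) = - (LINT x|lebesgue_on \<Omega>. \<phi> x *\<^sub>R grad f x)"
    unfolding vec_eq_iff
  proof
    fix i
    show "(LINT x|lebesgue_on \<Omega>. f x *\<^sub>R grad \<phi> x) $ i = (- (LINT x|lebesgue_on \<Omega>. \<phi> x *\<^sub>R grad f x)) $ i"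
      using test_function_integration_by_parts[OF assms \<phi>, of i]
      unfolding vector_uminus_component integral_vec_nth[OF int(1)] integral_vec_nth[OF int(2)]
        vector_scaleR_component real_scaleR_def
      by (simp only: mult.commute)
  qed
qed

text \<open>Each component of \<open>g - h\<close> is orthogonal to all test functions. This makes
  the representative chosen by \<open>weak_grad\<close> usable in computations.\<close>

lemma weak_gradient_AE_unique:
  fixes \<Omega> :: "(real^'n) set"
  assumes "open \<Omega>" "bounded \<Omega>" "g \<in> L2 \<Omega>" "h \<in> L2 \<Omega>" "has_weak_gradient \<Omega> u g" "has_weak_gradient \<Omega> u h"
  shows "AE x in lebesgue_on \<Omega>. g x = h x"
proof -
  have int: "integrable (lebesgue_on \<Omega>) g" "integrable (lebesgue_on \<Omega>) h"
    using assms by (auto intro: L2_imp_integrable)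
  have "AE x in lebesgue_on \<Omega>. (g x - h x) $ i = 0" for i
  proof (rule fundamental_lemma_calculus_of_variations[OF assms(1)])
    show "integrable (lebesgue_on \<Omega>) (\<lambda>x. (g x - h x) $ i)"
      using int by (intro integrable_vec_nth Bochner_Integration.integrable_diff)
    fix \<psi> assume \<psi>: "\<psi> \<in> test_functions \<Omega>"
    note int' = int[THEN integrable_test_function_scaleR, OF \<psi>]
    have "(LINT x|lebesgue_on \<Omega>. \<psi> x * (g x - h x) $ i) =
        (LINT x|lebesgue_on \<Omega>. (\<psi> x *\<^sub>R g x) $ i - (\<psi> x *\<^sub>R h x) $ i)"
      by (intro Bochner_Integration.integral_cong refl) (simp add: right_diff_distrib)
    also have "\<dots> = (LINT x|lebesgue_on \<Omega>. \<psi> x *\<^sub>R g x) $ i - (LINT x|lebesgue_on \<Omega>. \<psi> x *\<^sub>R h x) $ i"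
      by (simp only: integral_vec_nth[OF int'(1)] integral_vec_nth[OF int'(2)]
          Bochner_Integration.integral_diff[OF int'[THEN integrable_vec_nth]])
    also have "(LINT x|lebesgue_on \<Omega>. \<psi> x *\<^sub>R g x) = (LINT x|lebesgue_on \<Omega>. \<psi> x *\<^sub>R h x)"
      using assms(5,6) \<psi> unfolding has_weak_gradient_def by (simp add: eq_neg_iff_add_eq_0)
    finally show "(LINT x|lebesgue_on \<Omega>. \<psi> x * (g x - h x) $ i) = 0" by simp
  qed
  then have "AE x in lebesgue_on \<Omega>. \<forall>i. (g x - h x) $ i = 0"
    by (simp add: AE_all_countable)
  then show ?thesis by eventually_elim (auto simp: vec_eq_iff)
qed

lemma weak_grad_properties:
  assumes "u \<in> H1 \<Omega>"
  shows "weak_grad \<Omega> u \<in> L2 \<Omega>" "has_weak_gradient \<Omega> u (weak_grad \<Omega> u)"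
proof -
  have "\<exists>g. g \<in> L2 \<Omega> \<and> has_weak_gradient \<Omega> u g"
    using assms by (auto simp: H1_def)
  then have *: "weak_grad \<Omega> u \<in> L2 \<Omega> \<and> has_weak_gradient \<Omega> u (weak_grad \<Omega> u)"
    unfolding weak_grad_def by (rule someI_ex)
  show "weak_grad \<Omega> u \<in> L2 \<Omega>" by (rule conjunct1[OF *])
  show "has_weak_gradient \<Omega> u (weak_grad \<Omega> u)" by (rule conjunct2[OF *])
qed

text \<open>The classical gradient is a weak gradient by integration by parts, and uniqueness
  identifies it with the chosen one. The constant sequence then serves as the approximation required
  by \<open>H01\<close>.\<close>

lemma
  fixes \<Omega> :: "(real^'n) set"
  assumes "open \<Omega>" "bounded \<Omega>" "\<phi> \<in> test_functions \<Omega>"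
  shows test_function_weak_grad: "AE x in lebesgue_on \<Omega>. weak_grad \<Omega> \<phi> x = grad \<phi> x"
    and test_function_in_H01: "\<phi> \<in> H01 \<Omega>"
proof -
  note \<phi> = test_functionsD(1)[OF assms(3)]
  note g = L2_continuous[OF assms(1,2) continuous_on_grad[OF \<phi>]]
    smooth_has_weak_gradient[OF assms(1,2) \<phi>]
  have H1: "\<phi> \<in> H1 \<Omega>"
    using L2_continuous[OF assms(1,2) smooth_continuous_on[OF \<phi>]] g unfolding H1_def by blast
  note wg = weak_grad_properties[OF H1]
  show eq: "AE x in lebesgue_on \<Omega>. weak_grad \<Omega> \<phi> x = grad \<phi> x"
    by (rule weak_gradient_AE_unique[OF assms(1,2) wg(1) g(1) wg(2) g(2)])
  then have "AE x in lebesgue_on \<Omega>. (norm (grad \<phi> x - weak_grad \<Omega> \<phi> x))\<^sup>2 = 0"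
    by eventually_elim simp
  then have "(LINT x|lebesgue_on \<Omega>. (norm (grad \<phi> x - weak_grad \<Omega> \<phi> x))\<^sup>2) = 0"
    by (rule integral_eq_zero_AE)
  then have "(\<lambda>n::nat. (LINT x|lebesgue_on \<Omega>. (\<phi> x - \<phi> x)\<^sup>2)
      + (LINT x|lebesgue_on \<Omega>. (norm (grad \<phi> x - weak_grad \<Omega> \<phi> x))\<^sup>2)) \<longlonglongrightarrow> 0"
    by simp
  then show "\<phi> \<in> H01 \<Omega>"
    unfolding H01_def using H1 assms(3) by (intro CollectI conjI exI[of _ "\<lambda>_. \<phi>"] allI)
qed

subsection \<open>The comparison principle\<close>

definition laplacian :: "(real^'n \<Rightarrow> real) \<Rightarrow> real^'n \<Rightarrow> real" where
  "laplacian w x = (\<Sum>i\<in>UNIV. grad (\<lambda>y. grad w y $ i) x $ i)"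

lemma smooth_laplacian: "smooth w \<Longrightarrow> smooth (laplacian w)"
  unfolding laplacian_def[abs_def] by (intro smooth_sum smooth_grad_nth)

text \<open>Integration by parts in each coordinate, applied to the components of
  \<open>grad w\<close>; the boundary term is absent because of the support of
  \<open>\<phi>\<close>.\<close>

lemma Green_identity:
  fixes \<Omega> :: "(real^'n) set"
  assumes "open \<Omega>" "bounded \<Omega>" "smooth w" "\<phi> \<in> test_functions \<Omega>"
  shows "(LINT x|lebesgue_on \<Omega>. grad w x \<bullet> grad \<phi> x) = - (LINT x|lebesgue_on \<Omega>. laplacian w x * \<phi> x)"
proof -
  note \<phi> = test_functionsD(1)[OF assms(4)]
  note sw = smooth_grad_nth[OF assms(3)]
  note int = integrable_lebesgue_on_continuous[OF assms(1,2) smooth_continuous_on]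
  have "(LINT x|lebesgue_on \<Omega>. grad w x \<bullet> grad \<phi> x) =
      (LINT x|lebesgue_on \<Omega>. (\<Sum>i\<in>UNIV. grad w x $ i * grad \<phi> x $ i))"
    by (simp add: inner_vec_def)
  also have "\<dots> = (\<Sum>i\<in>UNIV. LINT x|lebesgue_on \<Omega>. grad w x $ i * grad \<phi> x $ i)"
    by (intro Bochner_Integration.integral_sum int smooth_mult sw smooth_grad_nth[OF \<phi>])
  also have "\<dots> = (\<Sum>i\<in>UNIV. - (LINT x|lebesgue_on \<Omega>. grad (\<lambda>y. grad w y $ i) x $ i * \<phi> x))"
    by (intro sum.cong refl test_function_integration_by_parts[OF assms(1,2) sw assms(4)])
  also have "\<dots> = - (LINT x|lebesgue_on \<Omega>. (\<Sum>i\<in>UNIV. grad (\<lambda>y. grad w y $ i) x $ i * \<phi> x))"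
    unfolding sum_negf
    by (subst Bochner_Integration.integral_sum) (intro int smooth_mult smooth_grad_nth[OF sw] \<phi>, rule refl)
  finally show ?thesis by (simp add: laplacian_def sum_distrib_right)
qed

lemma grad_flat_zero_comp:
  assumes "smooth g"
  shows "grad (\<lambda>x. flat 0 (g x)) x = flat 2 (g x) *\<^sub>R grad g x"
proof -
  have "((\<lambda>x. flat 0 (g x)) has_derivative (\<lambda>h. flat 2 (g x) * frechet_derivative g (at x) h)) (at x)"
    using has_derivative_compose[OF smooth_has_derivative[OF assms, of x]
        flat_zero_has_derivative[of "g x", unfolded has_field_derivative_def]] .
  from frechet_derivative_at[OF this] show ?thesis
    by (simp add: vec_eq_iff grad_nth fun_eq_iff)
qed

lemma grad_diff:
  assumes "smooth f" "smooth g"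
  shows "grad (\<lambda>x. f x - g x) x = grad f x - grad g x"
  using frechet_derivative_at[OF has_derivative_diff[OF smooth_has_derivative[OF assms(1), of x]
      smooth_has_derivative[OF assms(2), of x]]]
  by (simp add: vec_eq_iff grad_nth fun_eq_iff)

lemma grad_const: "grad (\<lambda>x. c) x = 0"
  by (simp add: vec_eq_iff grad_nth frechet_derivative_const)

lemma H01_in_L2: "u \<in> H01 \<Omega> \<Longrightarrow> u \<in> L2 \<Omega>" "u \<in> H01 \<Omega> \<Longrightarrow> weak_grad \<Omega> u \<in> L2 \<Omega>"
  using weak_grad_properties(1)[of u \<Omega>] by (auto simp: H01_def H1_def)

lemma H01_approximation:
  fixes \<Omega> :: "(real^'n) set"
  assumes "u \<in> H01 \<Omega>"
  obtains \<phi> where "\<And>n::nat. \<phi> n \<in> test_functions \<Omega>"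
    "(\<lambda>n. LINT x|lebesgue_on \<Omega>. (\<phi> n x - u x)\<^sup>2) \<longlonglongrightarrow> 0"
    "(\<lambda>n. LINT x|lebesgue_on \<Omega>. (norm (grad (\<phi> n) x - weak_grad \<Omega> u x))\<^sup>2) \<longlonglongrightarrow> 0"
proof -
  obtain \<phi> where \<phi>: "\<And>n::nat. \<phi> n \<in> test_functions \<Omega>"
    and lim: "(\<lambda>n. (LINT x|lebesgue_on \<Omega>. (\<phi> n x - u x)\<^sup>2)
         + (LINT x|lebesgue_on \<Omega>. (norm (grad (\<phi> n) x - weak_grad \<Omega> u x))\<^sup>2)) \<longlonglongrightarrow> 0"
    using assms unfolding H01_def by blast
  have *: "0 \<le> (LINT x|lebesgue_on \<Omega>. (\<phi> n x - u x)\<^sup>2)"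
    "0 \<le> (LINT x|lebesgue_on \<Omega>. (norm (grad (\<phi> n) x - weak_grad \<Omega> u x))\<^sup>2)" for n
    by (simp_all add: Bochner_Integration.integral_nonneg)
  show thesis
  proof (rule that[OF \<phi>])
    show "(\<lambda>n. LINT x|lebesgue_on \<Omega>. (\<phi> n x - u x)\<^sup>2) \<longlonglongrightarrow> 0"
      by (rule Lim_null_comparison[OF _ lim]) (use * in simp)
    show "(\<lambda>n. LINT x|lebesgue_on \<Omega>. (norm (grad (\<phi> n) x - weak_grad \<Omega> u x))\<^sup>2) \<longlonglongrightarrow> 0"
      by (rule Lim_null_comparison[OF _ lim]) (use * in simp)
  qed
qed

text \<open>A violation at one point would persist on a nonempty open set, and such a set is not
  negligible.\<close>

lemma AE_lebesgue_on_le_continuous: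
  fixes \<Omega> :: "(real^'n) set"
  assumes "open \<Omega>" "continuous_on \<Omega> f" "continuous_on \<Omega> g" "AE x in lebesgue_on \<Omega>. f x \<le> g x" "x \<in> \<Omega>"
  shows "f x \<le> (g x :: real)"
proof (rule ccontr)
  assume "\<not> f x \<le> g x"
  define U where "U = \<Omega> \<inter> (\<lambda>x. f x - g x) -` {0<..}"
  have "open U"
    unfolding U_def using assms(1-3)
    by (intro continuous_open_preimage continuous_on_diff open_greaterThan)
  moreover have "U \<noteq> {}" using \<open>\<not> f x \<le> g x\<close> assms(5) by (auto simp: U_def)
  ultimately have "U \<notin> null_sets lebesgue"
    using open_not_negligible by (auto simp: negligible_iff_null_sets)
  moreover have "AE x in lebesgue. x \<notin> U"
    using assms(1,4) by (subst (asm) AE_restrict_space_iff) (auto simp: U_def)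
  then have "U \<in> null_sets lebesgue"
    using \<open>open U\<close> by (subst AE_iff_null_sets) auto
  ultimately show False by simp
qed

text \<open>
  Testing the equation with \<open>flat 0 (\<phi>\<^sub>n - w - d)\<close>, a smooth substitute for
  \<open>(\<phi>\<^sub>n - w)\<^sup>+\<close>, keeps all test functions smooth, so that no chain rule in \<open>H01\<close> is needed.
\<close>

lemma comparison_principle:
  fixes \<Omega> :: "(real^'n) set" and u f w :: "real^'n \<Rightarrow> real"
  assumes \<Omega>: "open \<Omega>" "bounded \<Omega>"
    and u: "u \<in> H01 \<Omega>" "continuous_on \<Omega> u" and f: "f \<in> L2 \<Omega>"
    and weak: "\<And>v. v \<in> H01 \<Omega> \<Longrightarrow>
      (LINT x|lebesgue_on \<Omega>. weak_grad \<Omega> u x \<bullet> weak_grad \<Omega> v x) = (LINT x|lebesgue_on \<Omega>. f x * v x)"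
    and w: "smooth w" "\<And>x. 0 \<le> w x"
    and super: "AE x in lebesgue_on \<Omega>. w x < u x \<longrightarrow> f x + laplacian w x < 0"
    and x: "x \<in> \<Omega>"
  shows "u x \<le> w x"
proof (rule field_le_epsilon)
  fix d :: real assume "d > 0"
  let ?M = "lebesgue_on \<Omega>"
  obtain \<phi> where \<phi>: "\<And>n::nat. \<phi> n \<in> test_functions \<Omega>"
    and lim0: "(\<lambda>n. LINT x|?M. (\<phi> n x - u x)\<^sup>2) \<longlonglongrightarrow> 0"
    and lim1: "(\<lambda>n. LINT x|?M. (norm (grad (\<phi> n) x - weak_grad \<Omega> u x))\<^sup>2) \<longlonglongrightarrow> 0"
    using H01_approximation[OF u(1)] by blast
  note s\<phi> = test_functionsD(1)[OF \<phi>]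
  note uL2 = H01_in_L2[OF u(1)]
  note smoothL2 = L2_continuous[OF \<Omega> smooth_continuous_on] L2_continuous[OF \<Omega> continuous_on_grad]
  have L2M: "g \<in> borel_measurable ?M" "integrable ?M (\<lambda>x. (norm (g x))\<^sup>2)"
    if "g \<in> L2 \<Omega>" for g :: "real^'n \<Rightarrow> 'b::euclidean_space"
    using that by (simp_all add: L2_def)
  \<comment> \<open>In the weak sense \<open>u - w\<close> has negative Laplacian \<open>F\<close>,
    and \<open>p\<close> is its gradient.\<close>
  define F where "F x = f x + laplacian w x" for x
  define p where "p x = weak_grad \<Omega> u x - grad w x" for x
  have F: "F \<in> L2 \<Omega>"
    using L2_diff[OF f smoothL2(1)[OF smooth_diff[OF smooth_const[of 0] smooth_laplacian[OF w(1)]]]]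
    by (simp add: F_def[abs_def])
  have p: "p \<in> L2 \<Omega>"
    unfolding p_def[abs_def] by (intro L2_diff uL2 smoothL2 w)
  define g where "g n x = \<phi> n x - w x - d" for n x
  \<comment> \<open>The \<open>v n\<close> are admissible smooth test functions; \<open>V\<close> is
    the same expression with \<open>u\<close> in place of \<open>\<phi> n\<close>.\<close>
  define v where "v n x = flat 0 (g n x)" for n x
  define V where "V x = flat 0 (u x - w x - d)" for x
  have sg: "smooth (g n)" for n
    unfolding g_def[abs_def] by (intro smooth_diff s\<phi> w smooth_const)
  have grad_v: "grad (v n) x = flat 2 (g n x) *\<^sub>R (grad (\<phi> n) x - grad w x)" for n x
  proof -
    have "grad (g n) x = grad (\<phi> n) x - grad w x"
      unfolding g_def[abs_def]
      by (simp add: grad_diff smooth_diff s\<phi> w(1) smooth_const grad_const)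
    then show ?thesis
      unfolding v_def[abs_def] by (simp only: grad_flat_zero_comp[OF sg])
  qed
  have v: "v n \<in> test_functions \<Omega>" for n
  proof (rule test_functionsI)
    show "smooth (v n)" unfolding v_def[abs_def] by (intro smooth_comp[OF smooth_flat] sg)
    show "{x. v n x \<noteq> 0} \<subseteq> closure {x. \<phi> n x \<noteq> 0}"
    proof
      fix x assume "x \<in> {x. v n x \<noteq> 0}"
      \<comment> \<open>Where \<open>v n\<close> is nonzero, \<open>\<phi> n\<close> exceeds
        \<open>w + d\<close>, which is positive; hence the support of \<open>v n\<close> stays
        inside that of \<open>\<phi> n\<close>.\<close>
      then have "g n x > 0" using flat_nonpos_eq[of "g n x" 0] by (force simp: v_def)
      then have "\<phi> n x \<noteq> 0" using w(2)[of x] \<open>d > 0\<close> by (auto simp: g_def)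
      then show "x \<in> closure {x. \<phi> n x \<noteq> 0}" using closure_subset[of "{x. \<phi> n x \<noteq> 0}"] by auto
    qed
  qed (use test_functionsD[OF \<phi>] in auto)
  have vL2: "v n \<in> L2 \<Omega>" "grad (v n) \<in> L2 \<Omega>" for n
    using smoothL2 test_functionsD(1)[OF v] by blast+
  have weak_v: "(LINT x|?M. weak_grad \<Omega> u x \<bullet> grad (v n) x) = (LINT x|?M. f x * v n x)" for n
  proof -
    have "(LINT x|?M. weak_grad \<Omega> u x \<bullet> grad (v n) x) = (LINT x|?M. weak_grad \<Omega> u x \<bullet> weak_grad \<Omega> (v n) x)"
    proof (rule integral_cong_AE)
      show "(\<lambda>x. weak_grad \<Omega> u x \<bullet> grad (v n) x) \<in> borel_measurable ?M"
        by (rule borel_measurable_integrable[OF L2_inner_integrable[OF uL2(2) vL2(2)]])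
      show "(\<lambda>x. weak_grad \<Omega> u x \<bullet> weak_grad \<Omega> (v n) x) \<in> borel_measurable ?M"
        by (rule borel_measurable_integrable[OF L2_inner_integrable[OF uL2(2)
                H01_in_L2(2)[OF test_function_in_H01[OF \<Omega> v]]]])
      show "AE x in ?M. weak_grad \<Omega> u x \<bullet> grad (v n) x = weak_grad \<Omega> u x \<bullet> weak_grad \<Omega> (v n) x"
        using test_function_weak_grad[OF \<Omega> v[of n]] by eventually_elim simp
    qed
    then show ?thesis using weak[OF test_function_in_H01[OF \<Omega> v]] by simp
  qed
  \<comment> \<open>Green's identity for \<open>w\<close> is subtracted from the equation for
    \<open>u\<close>, both tested with \<open>v n\<close>.\<close>
  have energy: "(LINT x|?M. F x * v n x) = (LINT x|?M. p x \<bullet> grad (v n) x)" for n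
  proof -
    have "(LINT x|?M. F x * v n x) = (LINT x|?M. f x * v n x + laplacian w x * v n x)"
      by (simp add: F_def distrib_right)
    also have "\<dots> = (LINT x|?M. f x * v n x) + (LINT x|?M. laplacian w x * v n x)"
      using L2_inner_integrable[OF f vL2(1)] L2_inner_integrable[OF smoothL2(1)[OF smooth_laplacian[OF w(1)]] vL2(1)]
      by (intro Bochner_Integration.integral_add) (simp_all add: inner_real_def)
    also have "\<dots> = (LINT x|?M. weak_grad \<Omega> u x \<bullet> grad (v n) x) - (LINT x|?M. grad w x \<bullet> grad (v n) x)"
      using weak_v Green_identity[OF \<Omega> w(1) v] by simp
    also have "\<dots> = (LINT x|?M. p x \<bullet> grad (v n) x)"
      using L2_inner_integrable[OF uL2(2) vL2(2)] L2_inner_integrable[OF smoothL2(2)[OF w(1)] vL2(2)]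
      by (simp add: p_def inner_diff_left)
    finally show ?thesis .
  qed
  define X where "X n x = norm (grad (\<phi> n) x - weak_grad \<Omega> u x)" for n x
  have XL2: "(\<lambda>x. grad (\<phi> n) x - weak_grad \<Omega> u x) \<in> L2 \<Omega>" for n
    by (intro L2_diff smoothL2 s\<phi> uL2)
  have Xp: "(\<lambda>n. LINT x|?M. \<bar>X n x * norm (p x)\<bar>) \<longlonglongrightarrow> 0"
    unfolding X_def using L2M[OF XL2] L2M[OF p] lim1
    by (intro integral_mult_tendsto_0) simp_all
  have Xp_int: "integrable ?M (\<lambda>x. \<bar>X n x * norm (p x)\<bar>)" for n
    unfolding X_def using L2M[OF XL2] L2M[OF p]
    by (intro integrable_abs integrable_mult_square_integrable) simp_all
  have lower: "- 4 * (LINT x|?M. \<bar>X n x * norm (p x)\<bar>) \<le> (LINT x|?M. F x * v n x)" for n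
  proof -
    have "- 4 * (LINT x|?M. \<bar>X n x * norm (p x)\<bar>) = (LINT x|?M. - 4 * \<bar>X n x * norm (p x)\<bar>)"
      by simp
    also have "\<dots> \<le> (LINT x|?M. p x \<bullet> grad (v n) x)"
    proof (rule integral_mono)
      show "integrable ?M (\<lambda>x. - 4 * \<bar>X n x * norm (p x)\<bar>)" using Xp_int by simp
      show "integrable ?M (\<lambda>x. p x \<bullet> grad (v n) x)" by (rule L2_inner_integrable[OF p vL2(2)])
      fix x
      let ?y = "grad (\<phi> n) x - weak_grad \<Omega> u x"
      \<comment> \<open>Here \<open>grad (\<phi> n) - grad w\<close> is split into \<open>p\<close>
        and the approximation error. The first part contributes a nonnegative square; Cauchy-Schwarz
        and the bound \<open>4\<close> on \<open>flat 2\<close> control the second.\<close>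
      have "p x \<bullet> grad (v n) x = flat 2 (g n x) * (p x \<bullet> p x + p x \<bullet> ?y)"
        by (simp add: grad_v p_def inner_diff_right algebra_simps)
      moreover have "flat 2 (g n x) * - (X n x * norm (p x)) \<le> flat 2 (g n x) * (p x \<bullet> p x + p x \<bullet> ?y)"
      proof (rule mult_left_mono[OF _ flat_nonneg])
        have "\<bar>p x \<bullet> ?y\<bar> \<le> norm (p x) * norm ?y" by (rule Cauchy_Schwarz_ineq2)
        moreover have "0 \<le> p x \<bullet> p x" by simp
        ultimately show "- (X n x * norm (p x)) \<le> p x \<bullet> p x + p x \<bullet> ?y"
          unfolding X_def mult.commute[of "norm ?y"] by linarith
      qed
      moreover have "flat 2 (g n x) * (X n x * norm (p x)) \<le> 4 * \<bar>X n x * norm (p x)\<bar>"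
        using flat_two_le flat_nonneg by (intro mult_mono) (auto simp: X_def)
      ultimately show "- 4 * \<bar>X n x * norm (p x)\<bar> \<le> p x \<bullet> grad (v n) x" by linarith
    qed
    finally show ?thesis by (simp add: energy)
  qed
  have UL2: "(\<lambda>x. \<phi> n x - u x) \<in> L2 \<Omega>" for n
    by (intro L2_diff smoothL2 s\<phi> uL2)
  have "(\<lambda>n. LINT x|?M. \<bar>(\<phi> n x - u x) * F x\<bar>) \<longlonglongrightarrow> 0"
    using L2M[OF UL2] L2M[OF F] lim0 by (intro integral_mult_tendsto_0) simp_all
  then have Fu: "(\<lambda>n. 4 * (LINT x|?M. \<bar>(\<phi> n x - u x) * F x\<bar>)) \<longlonglongrightarrow> 0"
    by (rule tendsto_mult_right_zero)
  have Fu_int: "integrable ?M (\<lambda>x. \<bar>(\<phi> n x - u x) * F x\<bar>)" for n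
    using L2M[OF UL2] L2M[OF F] by (intro integrable_abs integrable_mult_square_integrable) simp_all
  have V_meas: "V \<in> borel_measurable ?M"
  proof -
    have "flat 0 \<in> borel_measurable borel"
      by (intro borel_measurable_continuous_onI smooth_continuous_on smooth_flat)
    moreover have "(\<lambda>x. u x - w x - d) \<in> borel_measurable ?M"
      using L2M(1)[OF uL2(1)] L2M(1)[OF smoothL2(1)[OF w(1)]] by simp
    ultimately show ?thesis unfolding V_def[abs_def] by (rule measurable_compose[rotated])
  qed
  have FV_int: "integrable ?M (\<lambda>x. F x * V x)"
  proof (rule Bochner_Integration.integrable_bound[OF L2_imp_integrable[OF \<Omega> F]])
    show "(\<lambda>x. F x * V x) \<in> borel_measurable ?M" using V_meas L2M(1)[OF F] by simp
    show "AE x in ?M. norm (F x * V x) \<le> norm (F x)"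
      by (rule AE_I2) (simp add: V_def abs_mult flat_nonneg flat_zero_le mult_left_le)
  qed
  have Fv_int: "integrable ?M (\<lambda>x. F x * v n x)" for n
    using L2_inner_integrable[OF F vL2(1)] by (simp add: inner_real_def)
  have "norm ((LINT x|?M. F x * v n x) - (LINT x|?M. F x * V x)) \<le> 4 * (LINT x|?M. \<bar>(\<phi> n x - u x) * F x\<bar>)" for n
  proof -
    have "norm ((LINT x|?M. F x * v n x) - (LINT x|?M. F x * V x)) = norm (LINT x|?M. F x * v n x - F x * V x)"
      using Fv_int FV_int by simp
    also have "\<dots> \<le> (LINT x|?M. norm (F x * v n x - F x * V x))" by (rule integral_norm_bound)
    also have "\<dots> \<le> (LINT x|?M. 4 * \<bar>(\<phi> n x - u x) * F x\<bar>)"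
    proof (rule integral_mono)
      show "integrable ?M (\<lambda>x. norm (F x * v n x - F x * V x))" using Fv_int FV_int by simp
      show "integrable ?M (\<lambda>x. 4 * \<bar>(\<phi> n x - u x) * F x\<bar>)" using Fu_int by simp
      fix x
      \<comment> \<open>The Lipschitz bound turns the convergence of \<open>\<phi> n\<close> to
        \<open>u\<close> in mean square into convergence of the integrals of
        \<open>F * v n\<close>.\<close>
      have "\<bar>v n x - V x\<bar> \<le> 4 * \<bar>\<phi> n x - u x\<bar>"
        using flat_zero_lipschitz[of "g n x" "u x - w x - d"] by (simp add: v_def V_def g_def)
      from mult_left_mono[OF this abs_ge_zero[of "F x"]]
      show "norm (F x * v n x - F x * V x) \<le> 4 * \<bar>(\<phi> n x - u x) * F x\<bar>"
        by (simp add: abs_mult mult.commute mult.left_commute flip: right_diff_distrib)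
    qed
    finally show ?thesis by simp
  qed
  then have "(\<lambda>n. (LINT x|?M. F x * v n x) - (LINT x|?M. F x * V x)) \<longlonglongrightarrow> 0"
    by (intro Lim_null_comparison[OF _ Fu]) simp
  then have "(\<lambda>n. LINT x|?M. F x * v n x) \<longlonglongrightarrow> (LINT x|?M. F x * V x)"
    by (simp add: LIM_zero_iff)
  moreover have "(\<lambda>n. - 4 * (LINT x|?M. \<bar>X n x * norm (p x)\<bar>)) \<longlonglongrightarrow> 0"
    by (rule tendsto_mult_right_zero[OF Xp])
  \<comment> \<open>The error in \<open>lower\<close> disappears in the limit; what remains of the
    energy is its nonnegative part.\<close>
  ultimately have nonneg: "0 \<le> (LINT x|?M. F x * V x)"
    using lower by (intro LIMSEQ_le[of "\<lambda>n. - 4 * (LINT x|?M. \<bar>X n x * norm (p x)\<bar>)"]) blast+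
  have V_pos: "V x > 0 \<Longrightarrow> w x < u x" and V_nonneg: "V x \<ge> 0" for x
    using flat_nonpos_eq[of "u x - w x - d" 0] \<open>d > 0\<close> flat_nonneg[of 0 "u x - w x - d"]
    by (force simp: V_def)+
  have sign: "AE x in ?M. 0 \<le> - (F x * V x)"
    using super
  proof eventually_elim
    case (elim x)
    then show ?case
      using V_pos[of x] V_nonneg[of x] by (cases "V x = 0") (auto simp: F_def mult_nonpos_nonneg)
  qed
  \<comment> \<open>The integrand \<open>F * V\<close> is nonpositive with nonnegative integral, so
    it vanishes almost everywhere. As \<open>F\<close> is negative wherever \<open>V\<close> is
    positive, \<open>V\<close> must vanish.\<close>
  have "(LINT x|?M. - (F x * V x)) = 0"
    using integral_nonneg_AE[OF sign] nonneg by simp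
  then have "AE x in ?M. - (F x * V x) = 0"
    using integral_nonneg_eq_0_iff_AE[OF _ sign] FV_int by simp
  with super have "AE x in ?M. u x \<le> w x + d"
  proof eventually_elim
    case (elim x)
    show ?case
    proof (rule ccontr)
      assume "\<not> u x \<le> w x + d"
      then have "V x > 0" by (simp add: V_def flat_pos)
      then show False using elim V_pos[of x] by (auto simp: F_def)
    qed
  qed
  then show "u x \<le> w x + d"
    using u(2) smooth_continuous_on[OF w(1)]
    by (intro AE_lebesgue_on_le_continuous[OF \<Omega>(1) _ _ _ x, of u "\<lambda>x. w x + d"] continuous_on_add continuous_on_const)
qed

subsection \<open>Barriers and the dead core\<close>

lemma smooth_norm_power:
  fixes x0 :: "real^'n"
  shows "smooth (\<lambda>y. c * ((y - x0) \<bullet> (y - x0)) ^ k)"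
proof -
  have "(\<lambda>y. c * ((y - x0) \<bullet> (y - x0)) ^ k) = (\<lambda>y. c * (\<Sum>i\<in>Basis. (y \<bullet> i - x0 \<bullet> i) * (y \<bullet> i - x0 \<bullet> i)) ^ k)"
    by (subst euclidean_inner) (simp add: inner_diff_left)
  then show ?thesis
    by (simp only:) (intro smooth_mult smooth_const smooth_power smooth_sum smooth_diff smooth_inner)
qed

text \<open>The exponent \<open>l + 2\<close> keeps all powers natural after two differentiations.
  Summing the squared coordinates gives back one factor of the squared distance, which merges the
  two terms.\<close>

lemma laplacian_norm_power:
  fixes x0 :: "real^'n"
  shows "laplacian (\<lambda>y. c * ((y - x0) \<bullet> (y - x0)) ^ (l + 2)) x =
    c * (2 * real (l + 2) * (real CARD('n) + 2 * real (l + 1))) * ((x - x0) \<bullet> (x - x0)) ^ (l + 1)"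
proof -
  let ?s = "\<lambda>y. (y - x0) \<bullet> (y - x0)"
  have hs: "(?s has_derivative (\<lambda>h. 2 * ((y - x0) \<bullet> h))) (at y)" for y
    by (auto intro!: derivative_eq_intros simp: inner_commute)
  have hp: "((\<lambda>y. ?s y ^ (k + 1)) has_derivative (\<lambda>h. real (k + 1) * (2 * ((y - x0) \<bullet> h)) * ?s y ^ k)) (at y)" for k y
    using has_derivative_power[OF hs, of "k + 1" y] by simp
  have g: "grad (\<lambda>y. c * ?s y ^ (l + 2)) y $ i = c * (2 * real (l + 2)) * (?s y ^ (l + 1) * (y - x0) $ i)"
    for y and i :: 'n
  proof -
    have "((\<lambda>y. c * ?s y ^ (l + 1 + 1)) has_derivative
        (\<lambda>h. c * (real (l + 1 + 1) * (2 * ((y - x0) \<bullet> h)) * ?s y ^ (l + 1)))) (at y)"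
      by (rule has_derivative_mult_right[OF hp])
    from frechet_derivative_at[OF this, symmetric] show ?thesis
      unfolding grad_nth by (simp add: inner_axis algebra_simps)
  qed
  have gg: "grad (\<lambda>y. grad (\<lambda>y. c * ?s y ^ (l + 2)) y $ i) x $ i =
      c * (2 * real (l + 2)) * (?s x ^ (l + 1) + 2 * real (l + 1) * ?s x ^ l * ((x - x0) $ i * (x - x0) $ i))" for i
  proof -
    have "((\<lambda>y. (y - x0) $ i) has_derivative (\<lambda>h. h $ i)) (at x)"
      by (auto intro!: derivative_eq_intros bounded_linear.has_derivative[OF bounded_linear_vec_nth])
    then have "((\<lambda>y. c * (2 * real (l + 2)) * (?s y ^ (l + 1) * (y - x0) $ i)) has_derivative
        (\<lambda>h. c * (2 * real (l + 2)) * (?s x ^ (l + 1) * h $ i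
          + real (l + 1) * (2 * ((x - x0) \<bullet> h)) * ?s x ^ l * (x - x0) $ i))) (at x)"
      by (intro has_derivative_mult_right has_derivative_mult hp)
    from frechet_derivative_at[OF this, symmetric] show ?thesis
      unfolding g grad_nth by (simp add: inner_axis algebra_simps)
  qed
  have "laplacian (\<lambda>y. c * ?s y ^ (l + 2)) x = c * (2 * real (l + 2)) *
      (\<Sum>i\<in>UNIV. ?s x ^ (l + 1) + 2 * real (l + 1) * ?s x ^ l * ((x - x0) $ i * (x - x0) $ i))"
    unfolding laplacian_def gg sum_distrib_left ..
  also have "(\<Sum>i\<in>UNIV. ?s x ^ (l + 1) + 2 * real (l + 1) * ?s x ^ l * ((x - x0) $ i * (x - x0) $ i)) =
      real CARD('n) * ?s x ^ (l + 1) + 2 * real (l + 1) * ?s x ^ l * ?s x"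
    unfolding sum.distrib sum_distrib_left[symmetric] by (simp add: inner_vec_def)
  finally show ?thesis by (simp add: algebra_simps)
qed

text \<open>
  For \<open>k (1 - \<alpha>) \<ge> 1\<close> the function \<open>\<bar>x - x\<^sub>0\<bar>\<^sup>2\<^sup>k\<close> vanishes at \<open>x\<^sub>0\<close> at least as fast as the
  dead core profile \<open>\<bar>x - x\<^sub>0\<bar>\<^bsup>2/(1-\<alpha>)\<^esup>\<close>; on a bounded set a small multiple of it is
  therefore still a supersolution, and unlike the profile it is smooth for integer \<open>k\<close>.
\<close>

lemma polynomial_supersolution:
  fixes \<alpha> m\<^sub>0 D :: real
  assumes "0 < \<alpha>" "\<alpha> < 1" "0 < m\<^sub>0" "0 < D"
  shows "\<exists>c>0. \<exists>l. \<forall>x x0 :: real^'n. (x - x0) \<bullet> (x - x0) \<le> D \<longrightarrow>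
      laplacian (\<lambda>y. c * ((y - x0) \<bullet> (y - x0)) ^ (l + 2)) x
        \<le> m\<^sub>0 * (c * ((x - x0) \<bullet> (x - x0)) ^ (l + 2)) powr \<alpha>"
proof -
  obtain l :: nat where "1 / (1 - \<alpha>) \<le> real l" using real_arch_simple by blast
  then have l: "1 \<le> real (l + 2) * (1 - \<alpha>)"
    using assms(2) by (simp add: pos_divide_le_eq algebra_simps)
  \<comment> \<open>The surplus of the exponent \<open>l + 1\<close> on the left over the exponent
    \<open>(l + 2) * \<alpha>\<close> on the right; the choice of \<open>l\<close> makes it
    nonnegative.\<close>
  define q where "q = real (l + 2) * (1 - \<alpha>) - 1"
  define k where "k = 2 * real (l + 2) * (real CARD('n) + 2 * real (l + 1))"
  \<comment> \<open>This solves \<open>c powr (1 - \<alpha>) * (k * D powr q) = m\<^sub>0\<close>,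
    where \<open>k\<close> is the constant in the Laplacian.\<close>
  define c where "c = (m\<^sub>0 / (k * D powr q)) powr (1 / (1 - \<alpha>))"
  have "k > 0" by (simp add: k_def add_nonneg_pos)
  have "q \<ge> 0" using l by (simp add: q_def)
  have kD: "k * D powr q > 0" using \<open>k > 0\<close> assms(4) by simp
  have "c > 0" using \<open>k > 0\<close> assms(3,4) by (simp add: c_def)
  have c_powr: "c powr (1 - \<alpha>) * (k * D powr q) = m\<^sub>0"
    using \<open>k > 0\<close> assms by (simp add: c_def powr_powr)
  show ?thesis
  proof (rule exI[of _ c], intro conjI \<open>c > 0\<close> exI[of _ l] allI impI)
    fix x x0 :: "real^'n"
    define s where "s = (x - x0) \<bullet> (x - x0)"
    assume "(x - x0) \<bullet> (x - x0) \<le> D"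
    then have "s \<le> D" "0 \<le> s" by (simp_all add: s_def)
    have "c * k * s ^ (l + 1) \<le> m\<^sub>0 * (c * s ^ (l + 2)) powr \<alpha>"
    proof (cases "s = 0")
      case False
      then have "s > 0" using \<open>0 \<le> s\<close> by simp
      have "c = c powr (1 - \<alpha>) * c powr \<alpha>"
        using \<open>c > 0\<close> by (simp flip: powr_add)
      moreover have "s ^ (l + 1) = s powr q * s powr (real (l + 2) * \<alpha>)"
      proof -
        have "q + real (l + 2) * \<alpha> = real (l + 1)" by (simp add: q_def algebra_simps)
        then show ?thesis using \<open>s > 0\<close> by (simp only: powr_realpow flip: powr_add)
      qed
      ultimately have "c * k * s ^ (l + 1) =
          (c powr (1 - \<alpha>) * (k * s powr q)) * (c powr \<alpha> * s powr (real (l + 2) * \<alpha>))"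
        by (metis mult.assoc mult.commute mult.left_commute)
      \<comment> \<open>Since \<open>q \<ge> 0\<close>, the surplus factor is largest at
        \<open>s = D\<close>, the case for which \<open>c\<close> was chosen.\<close>
      also have "\<dots> \<le> (c powr (1 - \<alpha>) * (k * D powr q)) * (c powr \<alpha> * s powr (real (l + 2) * \<alpha>))"
        using \<open>k > 0\<close> \<open>q \<ge> 0\<close> \<open>s \<le> D\<close> \<open>0 \<le> s\<close>
        by (intro mult_right_mono mult_left_mono powr_mono2) auto
      also have "c powr \<alpha> * s powr (real (l + 2) * \<alpha>) = (c * s ^ (l + 2)) powr \<alpha>"
        using \<open>c > 0\<close> \<open>s > 0\<close> by (simp only: powr_mult powr_powr flip: powr_realpow)
      finally show ?thesis unfolding c_powr .
    qed (use assms(3) in simp)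
    then show "laplacian (\<lambda>y. c * ((y - x0) \<bullet> (y - x0)) ^ (l + 2)) x
        \<le> m\<^sub>0 * (c * ((x - x0) \<bullet> (x - x0)) ^ (l + 2)) powr \<alpha>"
      unfolding laplacian_norm_power by (simp only: k_def s_def)
  qed
qed

section \<open>Comparison for ground states\<close>

lemma L2_AE_bounded:
  fixes \<Omega> :: "(real^'n) set" and f :: "real^'n \<Rightarrow> real"
  assumes "open \<Omega>" "bounded \<Omega>" "f \<in> borel_measurable (lebesgue_on \<Omega>)"
    and "AE x in lebesgue_on \<Omega>. \<bar>f x\<bar> \<le> C"
  shows "f \<in> L2 \<Omega>"
proof -
  interpret finite_measure "lebesgue_on \<Omega>"
    using assms(1,2) by (rule finite_measure_lebesgue_on[OF lmeasurable_open, rotated])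
  have "AE x in lebesgue_on \<Omega>. norm ((norm (f x))\<^sup>2) \<le> C\<^sup>2"
    using assms(4) by eventually_elim (simp add: abs_le_square_iff[symmetric])
  then have "integrable (lebesgue_on \<Omega>) (\<lambda>x. (norm (f x))\<^sup>2)"
    by (rule integrable_const_bound) (use assms(3) in simp)
  then show ?thesis using assms(3) by (simp add: L2_def)
qed

lemma abs_powr_mult_self:
  fixes t \<alpha> :: real
  assumes "0 \<le> t" shows "\<bar>t\<bar> powr (\<alpha> - 1) * t = t powr \<alpha>"
  using assms by (cases "t = 0") (simp_all add: powr_diff)

text \<open>Continuity on the compact closure bounds \<open>u\<close>, and \<open>m\<close> is
  essentially bounded; on a set of finite measure this suffices.\<close>

lemma reaction_term_in_L2:
  fixes \<Omega> :: "(real^'n) set"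
  assumes \<Omega>: "open \<Omega>" "bounded \<Omega>" and "0 < \<alpha>" and m: "m \<in> Linfty \<Omega>"
    and u: "u \<in> L2 \<Omega>" "continuous_on (closure \<Omega>) u" "\<And>x. x \<in> \<Omega> \<Longrightarrow> 0 \<le> u x"
  shows "(\<lambda>x. lam * u x + m x * (\<bar>u x\<bar> powr (\<alpha> - 1) * u x)) \<in> L2 \<Omega>"
proof -
  obtain K where K: "AE x in lebesgue_on \<Omega>. \<bar>m x\<bar> \<le> K" and [measurable]: "m \<in> borel_measurable (lebesgue_on \<Omega>)"
    using m by (auto simp: Linfty_def)
  have [measurable]: "u \<in> borel_measurable (lebesgue_on \<Omega>)" using u(1) by (simp add: L2_def)
  have "bounded (u ` closure \<Omega>)"
    using \<Omega>(2) u(2) by (intro compact_imp_bounded compact_continuous_image) auto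
  then obtain B where "\<forall>y\<in>u ` closure \<Omega>. norm y \<le> B" unfolding bounded_iff by blast
  then have B: "u x \<le> B" if "x \<in> \<Omega>" for x using that closure_subset[of \<Omega>] by fastforce
  have AE_\<Omega>: "AE x in lebesgue_on \<Omega>. x \<in> \<Omega>" by (rule AE_I2) simp
  show ?thesis
  proof (rule L2_AE_bounded[OF \<Omega>])
    show "(\<lambda>x. lam * u x + m x * (\<bar>u x\<bar> powr (\<alpha> - 1) * u x)) \<in> borel_measurable (lebesgue_on \<Omega>)"
      by measurable
    show "AE x in lebesgue_on \<Omega>. \<bar>lam * u x + m x * (\<bar>u x\<bar> powr (\<alpha> - 1) * u x)\<bar> \<le> \<bar>lam\<bar> * B + K * B powr \<alpha>"
      using K AE_\<Omega>
    proof eventually_elim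
      case (elim x)
      note ux = u(3)[OF elim(2)] B[OF elim(2)]
      have "\<bar>lam * u x + m x * u x powr \<alpha>\<bar> \<le> \<bar>lam\<bar> * u x + \<bar>m x\<bar> * u x powr \<alpha>"
        using abs_triangle_ineq[of "lam * u x" "m x * u x powr \<alpha>"] ux by (simp add: abs_mult)
      also have "\<dots> \<le> \<bar>lam\<bar> * B + K * B powr \<alpha>"
        using elim(1) ux \<open>0 < \<alpha>\<close> by (intro add_mono mult_left_mono mult_mono powr_mono2) auto
      finally show ?case unfolding abs_powr_mult_self[OF ux(1)] .
    qed
  qed
qed

text \<open>The comparison principle with the reaction term as \<open>f\<close>; the sign of
  \<open>u\<close> reduces the nonlinearity to \<open>u powr \<alpha>\<close>.\<close>

lemma plus_ground_state_comparison:
  fixes \<Omega> :: "(real^'n) set"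
  assumes \<Omega>: "open \<Omega>" "bounded \<Omega>" and "0 < \<alpha>" and m: "m \<in> Linfty \<Omega>"
    and u: "plus_ground_state \<Omega> m \<alpha> lam u"
    and w: "smooth w" "\<And>x. 0 \<le> w x"
    and super: "AE x in lebesgue_on \<Omega>. w x < u x \<longrightarrow> lam * u x + m x * u x powr \<alpha> + laplacian w x < 0"
    and x: "x \<in> \<Omega>"
  shows "u x \<le> w x"
proof (rule comparison_principle[OF \<Omega> _ _ _ _ w _ x])
  have cont: "continuous_on (closure \<Omega>) u" and nonneg: "\<And>x. x \<in> \<Omega> \<Longrightarrow> 0 \<le> u x"
    and sol: "weak_solution \<Omega> m \<alpha> lam u"
    using u by (auto simp: plus_ground_state_def)
  show H: "u \<in> H01 \<Omega>" using sol by (simp add: weak_solution_def)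
  show "continuous_on \<Omega> u" using cont closure_subset by (rule continuous_on_subset)
  show "(\<lambda>x. lam * u x + m x * (\<bar>u x\<bar> powr (\<alpha> - 1) * u x)) \<in> L2 \<Omega>"
    by (rule reaction_term_in_L2[OF \<Omega> \<open>0 < \<alpha>\<close> m H01_in_L2(1)[OF H] cont nonneg])
  show "(LINT x|lebesgue_on \<Omega>. weak_grad \<Omega> u x \<bullet> weak_grad \<Omega> v x) =
      (LINT x|lebesgue_on \<Omega>. (lam * u x + m x * (\<bar>u x\<bar> powr (\<alpha> - 1) * u x)) * v x)" if "v \<in> H01 \<Omega>" for v
    using sol that by (simp add: weak_solution_def)
  have "AE x in lebesgue_on \<Omega>. x \<in> \<Omega>" by (rule AE_I2) simp
  with super show "AE x in lebesgue_on \<Omega>. w x < u x \<longrightarrow>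
      lam * u x + m x * (\<bar>u x\<bar> powr (\<alpha> - 1) * u x) + laplacian w x < 0"
    by eventually_elim (simp only: abs_powr_mult_self nonneg)
qed

lemma laplacian_const: "laplacian (\<lambda>x. c) x = 0"
  by (simp add: laplacian_def grad_const)

text \<open>The barrier is the constant \<open>\<kappa>\<close>. Where \<open>u\<close> exceeds it,
  division by \<open>u powr \<alpha>\<close> leaves \<open>lam * u powr (1 - \<alpha>) + m\<close>,
  which the bound on \<open>lam\<close> makes negative.\<close>

lemma plus_ground_state_upper_bound:
  fixes \<Omega> :: "(real^'n) set"
  assumes \<Omega>: "open \<Omega>" "bounded \<Omega>" and \<alpha>: "0 < \<alpha>" "\<alpha> < 1" and m: "m \<in> Linfty \<Omega>"
    and K: "AE x in lebesgue_on \<Omega>. \<bar>m x\<bar> \<le> K" "0 < K" and \<kappa>: "0 < \<kappa>"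
    and lam: "lam < - K / \<kappa> powr (1 - \<alpha>)"
    and u: "plus_ground_state \<Omega> m \<alpha> lam u" and x: "x \<in> \<Omega>"
  shows "u x \<le> \<kappa>"
proof (rule plus_ground_state_comparison[OF \<Omega> \<alpha>(1) m u smooth_const _ _ x])
  have "- K / \<kappa> powr (1 - \<alpha>) < 0" using K(2) \<kappa> by simp
  then have "lam < 0" using lam by simp
  show "AE x in lebesgue_on \<Omega>. \<kappa> < u x \<longrightarrow> lam * u x + m x * u x powr \<alpha> + laplacian (\<lambda>x. \<kappa>) x < 0"
    using K(1)
  proof eventually_elim
    case (elim x)
    show ?case
    proof
      assume "\<kappa> < u x"
      then have pos: "0 < u x" using \<kappa> by simp
      have "\<kappa> powr (1 - \<alpha>) < u x powr (1 - \<alpha>)"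
        using \<open>\<kappa> < u x\<close> \<kappa> \<alpha> by (intro powr_less_mono2) auto
      then have "lam * u x powr (1 - \<alpha>) < lam * \<kappa> powr (1 - \<alpha>)"
        using \<open>lam < 0\<close> by (rule mult_strict_left_mono_neg)
      also have "\<dots> < - K"
        using lam \<kappa> by (simp add: pos_less_divide_eq[symmetric])
      finally have "lam * u x powr (1 - \<alpha>) + m x < 0" using elim by linarith
      then have "(lam * u x powr (1 - \<alpha>) + m x) * u x powr \<alpha> < 0"
        using pos by (intro mult_neg_pos) auto
      moreover have "u x powr (1 - \<alpha>) * u x powr \<alpha> = u x"
        using pos by (simp flip: powr_add)
      ultimately show "lam * u x + m x * u x powr \<alpha> + laplacian (\<lambda>x. \<kappa>) x < 0"
        by (simp add: laplacian_const distrib_right mult.assoc)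
    qed
  qed
qed (use \<kappa> in simp)

text \<open>Ensures that a ground state is available for every negative \<open>lam\<close>.\<close>

lemma lambda_star_nonneg: "0 \<le> lambda_star \<Omega> m \<alpha>"
  unfolding lambda_star_def
  by (intro INF_greatest) (auto intro!: divide_nonneg_nonneg Bochner_Integration.integral_nonneg)

theorem theorem3:
  fixes \<Omega> :: "(real^'n) set" and m :: "real^'n \<Rightarrow> real"
    and \<alpha> \<rho>\<^sub>0 m\<^sub>0 :: real and u :: "real \<Rightarrow> real^'n \<Rightarrow> real"
  assumes "open \<Omega>" and "connected \<Omega>" and "bounded \<Omega>" and "Ck_boundary 1 \<Omega>"
    and "0 < \<alpha>" and "\<alpha> < 1"
    and "m \<in> Linfty \<Omega>"
    and "measure lebesgue (pos_set \<Omega> m) > 0"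
    and "measure lebesgue (neg_set \<Omega> m) > 0"
    and "\<rho>\<^sub>0 > 0" and "m\<^sub>0 > 0"
    and "collar \<Omega> \<rho>\<^sub>0 \<subseteq> neg_set \<Omega> m"
    and "AE x in lebesgue_on (collar \<Omega> \<rho>\<^sub>0). - m x \<ge> m\<^sub>0"
    and "\<And>lam. ereal lam < lambda_star \<Omega> m \<alpha> \<Longrightarrow> plus_ground_state \<Omega> m \<alpha> lam (u lam)"
  shows "\<exists>\<sigma><0. \<exists>\<rho>. 0 < \<rho> \<and> \<rho> < \<rho>\<^sub>0 \<and>
           compactly_contained {x \<in> \<Omega>. infdist x (frontier \<Omega>) \<ge> \<rho>} \<Omega> \<and>
           (\<forall>lam<\<sigma>. compact (supp_in \<Omega> (u lam)) \<and> supp_in \<Omega> (u lam) \<subseteq> \<Omega> \<and>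
                   (\<forall>x\<in>collar \<Omega> \<rho>. u lam x = 0) \<and>
                   supp_in \<Omega> (u lam) \<subseteq> {x \<in> \<Omega>. infdist x (frontier \<Omega>) \<ge> \<rho>})"
proof -
  note \<Omega> = assms(1,3)
  obtain K0 where "AE x in lebesgue_on \<Omega>. \<bar>m x\<bar> \<le> K0"
    using assms(7) by (auto simp: Linfty_def)
  \<comment> \<open>Adding \<open>1\<close> makes the bound strictly positive, as the upper bound
    for ground states requires.\<close>
  then have K: "AE x in lebesgue_on \<Omega>. \<bar>m x\<bar> \<le> \<bar>K0\<bar> + 1"
    by eventually_elim simp
  obtain R where R: "R > 0" "\<And>x. x \<in> \<Omega> \<Longrightarrow> norm x \<le> R"
    using \<Omega>(2) unfolding bounded_pos by blast
  have D: "(x - y) \<bullet> (x - y) \<le> (2 * R)\<^sup>2" if "x \<in> \<Omega>" "y \<in> \<Omega>" for x y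
  proof -
    have "norm (x - y) \<le> 2 * R" using norm_triangle_ineq4[of x y] R(2)[OF that(1)] R(2)[OF that(2)] by linarith
    then have "(norm (x - y))\<^sup>2 \<le> (2 * R)\<^sup>2" by (intro power_mono) auto
    then show ?thesis by (simp add: power2_norm_eq_inner)
  qed
  have "(2 * R)\<^sup>2 > 0" using R(1) by simp
  obtain c l where "0 < c" and lap: "\<forall>x x0 :: real^'n. (x - x0) \<bullet> (x - x0) \<le> (2 * R)\<^sup>2 \<longrightarrow>
      laplacian (\<lambda>y. c * ((y - x0) \<bullet> (y - x0)) ^ (l + 2)) x
        \<le> m\<^sub>0 * (c * ((x - x0) \<bullet> (x - x0)) ^ (l + 2)) powr \<alpha>"
    using polynomial_supersolution[where 'n = 'n, OF assms(5,6,11) \<open>(2 * R)\<^sup>2 > 0\<close>] by blast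
  \<comment> \<open>Halving leaves a gap of width \<open>\<rho>\<close> between the collar where
    \<open>u\<close> will vanish and the complement of the collar where \<open>m\<close> is
    controlled.\<close>
  define \<rho> where "\<rho> = \<rho>\<^sub>0 / 2"
  \<comment> \<open>The value of the barrier at distance \<open>\<rho>\<close> from its centre; it
    does not depend on the centre, so \<open>\<sigma>\<close> does not either.\<close>
  define \<kappa> where "\<kappa> = c * (\<rho>\<^sup>2) ^ (l + 2)"
  \<comment> \<open>The threshold below which \<open>plus_ground_state_upper_bound\<close> yields
    \<open>u \<le> \<kappa>\<close>.\<close>
  define \<sigma> where "\<sigma> = - (\<bar>K0\<bar> + 1) / \<kappa> powr (1 - \<alpha>)"
  have \<rho>: "0 < \<rho>" "\<rho> < \<rho>\<^sub>0" using assms(10) by (auto simp: \<rho>_def)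
  have "\<kappa> > 0" using \<rho> \<open>0 < c\<close> by (simp add: \<kappa>_def)
  then have "\<sigma> < 0" unfolding \<sigma>_def by (intro divide_neg_pos) auto
  have collar_open: "collar \<Omega> \<rho>\<^sub>0 \<in> sets lebesgue"
  proof -
    have "collar \<Omega> \<rho>\<^sub>0 = \<Omega> \<inter> (\<lambda>x. infdist x (frontier \<Omega>)) -` {..<\<rho>\<^sub>0}"
      by (auto simp: collar_def)
    also have "open \<dots>"
      by (intro continuous_open_preimage \<Omega> continuous_on_infdist continuous_on_id open_lessThan)
    finally show ?thesis by simp
  qed
  have m_collar: "AE x in lebesgue_on \<Omega>. x \<in> collar \<Omega> \<rho>\<^sub>0 \<longrightarrow> m x \<le> - m\<^sub>0"
  proof -
    have "AE x in lebesgue. x \<in> collar \<Omega> \<rho>\<^sub>0 \<longrightarrow> m x \<le> - m\<^sub>0"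
      using assms(13) collar_open by (subst (asm) AE_restrict_space_iff) auto
    then have "AE x in lebesgue. x \<in> \<Omega> \<longrightarrow> x \<in> collar \<Omega> \<rho>\<^sub>0 \<longrightarrow> m x \<le> - m\<^sub>0"
      by eventually_elim simp
    then show ?thesis using \<Omega>(1) by (subst AE_restrict_space_iff) auto
  qed
  have vanish: "u lam x0 = 0" if "lam < \<sigma>" "x0 \<in> collar \<Omega> \<rho>" for lam x0
  proof -
    have "lam < 0" using that(1) \<open>\<sigma> < 0\<close> by simp
    then have gs: "plus_ground_state \<Omega> m \<alpha> lam (u lam)"
      by (intro assms(14) less_le_trans[OF _ lambda_star_nonneg]) simp
    have x0: "x0 \<in> \<Omega>" "infdist x0 (frontier \<Omega>) < \<rho>" using that(2) by (auto simp: collar_def)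
    have bound: "u lam x \<le> \<kappa>" if "x \<in> \<Omega>" for x
      using \<open>lam < \<sigma>\<close> \<open>\<kappa> > 0\<close>
      by (intro plus_ground_state_upper_bound[OF \<Omega> assms(5,6,7) K _ _ _ gs that]) (auto simp: \<sigma>_def)
    define w where "w y = c * ((y - x0) \<bullet> (y - x0)) ^ (l + 2)" for y
    have w: "smooth w" unfolding w_def[abs_def] by (rule smooth_norm_power)
    have w_nonneg: "0 \<le> w x" for x using \<open>0 < c\<close> by (simp add: w_def)
    \<comment> \<open>The centre \<open>x0\<close> is closer than \<open>\<rho>\<close> to the
      frontier and \<open>x\<close> is at least \<open>2 * \<rho>\<close> away from it, so the two
      points are at least \<open>\<rho>\<close> apart.\<close>
    have far: "\<kappa> \<le> w x" if "x \<in> \<Omega>" "x \<notin> collar \<Omega> \<rho>\<^sub>0" for x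
    proof -
      have "\<rho>\<^sub>0 \<le> infdist x (frontier \<Omega>)" using that by (simp add: collar_def not_less)
      also have "\<dots> \<le> infdist x0 (frontier \<Omega>) + dist x x0" by (rule infdist_triangle)
      finally have "\<rho> \<le> norm (x - x0)" using x0(2) by (simp add: \<rho>_def dist_norm)
      then have "\<rho>\<^sup>2 \<le> (x - x0) \<bullet> (x - x0)"
        using \<rho>(1) by (simp add: power_mono flip: power2_norm_eq_inner)
      then show ?thesis
        unfolding \<kappa>_def w_def using \<open>0 < c\<close> by (intro mult_left_mono power_mono) auto
    qed
    have "AE x in lebesgue_on \<Omega>. x \<in> \<Omega>" by (rule AE_I2) simp
    with m_collar have "AE x in lebesgue_on \<Omega>. w x < u lam x \<longrightarrow>
        lam * u lam x + m x * u lam x powr \<alpha> + laplacian w x < 0"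
    proof eventually_elim
      case (elim x)
      show ?case
      proof
        assume less: "w x < u lam x"
        \<comment> \<open>Outside this collar \<open>u \<le> \<kappa> \<le> w\<close>, so the
          barrier can only be exceeded where the absorption is available.\<close>
        then have "x \<in> collar \<Omega> \<rho>\<^sub>0" using far[of x] bound[OF elim(2)] elim(2) by force
        then have "m x \<le> - m\<^sub>0" using elim by simp
        have pos: "0 < u lam x" using less w_nonneg[of x] by simp
        have "m x * u lam x powr \<alpha> \<le> - m\<^sub>0 * u lam x powr \<alpha>"
          using \<open>m x \<le> - m\<^sub>0\<close> by (intro mult_right_mono) auto
        moreover have "laplacian w x \<le> m\<^sub>0 * w x powr \<alpha>"
          unfolding w_def[abs_def] by (rule lap[rule_format, OF D[OF elim(2) x0(1)]])
        moreover have "m\<^sub>0 * w x powr \<alpha> \<le> m\<^sub>0 * u lam x powr \<alpha>"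
          using less w_nonneg assms(5,11) by (intro mult_left_mono powr_mono2) auto
        moreover have "lam * u lam x < 0" using \<open>lam < 0\<close> pos by (simp add: mult_neg_pos)
        ultimately show "lam * u lam x + m x * u lam x powr \<alpha> + laplacian w x < 0"
          by linarith
      qed
    qed
    then have "u lam x0 \<le> w x0"
      by (rule plus_ground_state_comparison[OF \<Omega> assms(5,7) gs w w_nonneg _ x0(1)])
    moreover have "w x0 = 0" by (simp add: w_def)
    moreover have "0 \<le> u lam x0" using gs x0(1) by (simp add: plus_ground_state_def)
    ultimately show ?thesis by simp
  qed

  \<comment> \<open>Compact containment of the support\<close>
  let ?A = "{x \<in> \<Omega>. infdist x (frontier \<Omega>) \<ge> \<rho>}"
  \<comment> \<open>Points of the closure outside \<open>\<Omega>\<close> lie on the frontier, at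
    distance zero from it. Passing to the closure therefore adds nothing and shows that the set is
    closed.\<close>
  have A_eq: "?A = closure \<Omega> \<inter> (\<lambda>x. infdist x (frontier \<Omega>)) -` {\<rho>..}"
  proof -
    have "infdist x (frontier \<Omega>) = 0" if "x \<in> closure \<Omega>" "x \<notin> \<Omega>" for x
      using that \<Omega>(1) by (intro infdist_zero) (simp add: frontier_def interior_open)
    then show ?thesis using \<rho>(1) closure_subset[of \<Omega>] by force
  qed
  have "closed ?A"
    unfolding A_eq
    by (intro continuous_closed_preimage continuous_on_infdist continuous_on_id closed_closure closed_atLeast)
  have "bounded ?A" using \<Omega>(2) by (rule bounded_subset) auto
  with \<open>closed ?A\<close> have "compact ?A" by (simp add: compact_eq_bounded_closed)
  then have cc: "compactly_contained ?A \<Omega>"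
    using \<open>closed ?A\<close> by (auto simp: compactly_contained_def)
  have supp: "supp_in \<Omega> (u lam) \<subseteq> ?A" if "lam < \<sigma>" for lam
    unfolding supp_in_def
    by (rule closure_minimal[OF _ \<open>closed ?A\<close>]) (use vanish[OF that] in \<open>force simp: collar_def not_less\<close>)
  have "compact (supp_in \<Omega> (u lam))" if "lam < \<sigma>" for lam
  proof -
    have "closed (supp_in \<Omega> (u lam))" by (simp add: supp_in_def)
    moreover have "bounded (supp_in \<Omega> (u lam))"
      using \<open>bounded ?A\<close> supp[OF that] by (rule bounded_subset)
    ultimately show ?thesis by (simp add: compact_eq_bounded_closed)
  qed
  moreover have "supp_in \<Omega> (u lam) \<subseteq> \<Omega>" if "lam < \<sigma>" for lam
    using supp[OF that] by blast
  ultimately show ?thesis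
    using \<open>\<sigma> < 0\<close> \<rho> cc vanish supp by (intro exI[of _ \<sigma>] exI[of _ \<rho>] conjI allI impI ballI) blast+
qed

end
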